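(* Let $n,k\ge 1$, let $x_1,\dots,x_n\ge 0$ and $y_1,\dots,y_k\ge 0$, and let $\mu_{n,k}$ be the probability measure on partitions $\lambda$ contained in the $n\times k$ rectangle (at most $n$ parts, each at most $k$) given by $$\mu_{n,k}\bigl(\lambda\,|\,\{x_i\}_{i=1}^n,\{y_j\}_{j=1}^k\bigr)=\frac{s_\lambda(x_1,\dots,x_n)\,s_{\lambda'}(y_1,\dots,y_k)}{\prod_{i=1}^n\prod_{j=1}^k(1+x_iy_j)} .$$ Let $a_i:=\lambda_i-i+\tfrac12$. Then $\mu_{n,k}$ is a determinantal ensemble: $$\mu_{n,k}\bigl(\lambda\,|\,\{x_i\}_{i=1}^n,\{y_j\}_{j=1}^k\bigr)=\det\bigl[\mathcal K(a_i,a_j)\bigr]_{i,j=1}^n,$$ where, for half-integers $m,m'$, the correlation kernel is $$\mathcal K(m,m')=\oint\oint_{|w|<|z|}\frac{dz}{2\pi\mathbf i z}\,\frac{dw}{2\pi\mathbf i w}\,\frac{K(z)}{K(w)}\,z^{-m}w^{m'}\,\frac{\sqrt{zw}}{z-w},\qquad K(z)=\prod_{i=1}^n\frac1{1-x_iz}\prod_{j=1}^k\frac1{1+y_j/z},$$ and the contour for $z$ contains $-y_j$ for all $j$ and does not contain $x_i^{-1}$ for all $i$, and the contour for $w$ encircles zero.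
   Context: $\mathbf i=\sqrt{-1}$. $s_\lambda$ is the Schur polynomial and $\lambda'$ is the conjugate partition of $\lambda$. The contours are simple, closed and positively oriented, and the $w$-contour lies inside the $z$-contour, with $|w|<|z|$. Since $m,m'\in\mathbb Z+\frac12$, the expression $z^{-m}w^{m'}\sqrt{zw}$ is understood as $z^{-m+1/2}w^{m'+1/2}$, which has integer exponents. *)

theory Defs
  imports
    "HOL-Complex_Analysis.Complex_Analysis"
    "HOL-Probability.Probability"
    "Jordan_Normal_Form.Determinant"
begin

text \<open>
  All indices start at 0: \<open>lam i\<close> stands for $\lambda_{i+1}$, and the variables are
  \<open>x i\<close> for \<open>i < n\<close> and \<open>y j\<close> for \<open>j < k\<close>.
\<close>

definition is_partition :: "(nat \<Rightarrow> nat) \<Rightarrow> bool" where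
  "is_partition lam \<longleftrightarrow> antimono lam \<and> finite {i. lam i \<noteq> 0}"

definition rect_partitions :: "nat \<Rightarrow> nat \<Rightarrow> (nat \<Rightarrow> nat) set" where
  "rect_partitions n k =
     {lam. is_partition lam \<and> (\<forall>i. lam i \<le> k) \<and> (\<forall>i\<ge>n. lam i = 0)}"

definition conjugate :: "(nat \<Rightarrow> nat) \<Rightarrow> nat \<Rightarrow> nat" where
  "conjugate lam j = card {i. j < lam i}"

definition diagram :: "(nat \<Rightarrow> nat) \<Rightarrow> (nat \<times> nat) set" where
  "diagram lam = {(i, j). j < lam i}"

text \<open>Semistandard Young tableaux with entries in \<open>{0..<n}\<close>; they are extensional functions on
  the diagram, so that each tableau is counted once.\<close>

definition ssyt :: "nat \<Rightarrow> (nat \<Rightarrow> nat) \<Rightarrow> (nat \<times> nat \<Rightarrow> nat) set" where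
  "ssyt n lam = {T \<in> diagram lam \<rightarrow>\<^sub>E {..<n}.
     (\<forall>i j j'. j < j' \<and> (i, j') \<in> diagram lam \<longrightarrow> T (i, j) \<le> T (i, j')) \<and>
     (\<forall>i i' j. i < i' \<and> (i', j) \<in> diagram lam \<longrightarrow> T (i, j) < T (i', j))}"

text \<open>The value of the Schur polynomial $s_\lambda$ in \<open>n\<close> variables at the point
  \<open>x 0, \<dots>, x (n - 1)\<close>.\<close>

definition schur :: "nat \<Rightarrow> (nat \<Rightarrow> nat) \<Rightarrow> (nat \<Rightarrow> 'a::comm_semiring_1) \<Rightarrow> 'a" where
  "schur n lam x = (\<Sum>T\<in>ssyt n lam. \<Prod>c\<in>diagram lam. x (T c))"

definition schur_measure ::
  "nat \<Rightarrow> nat \<Rightarrow> (nat \<Rightarrow> real) \<Rightarrow> (nat \<Rightarrow> real) \<Rightarrow> (nat \<Rightarrow> nat) measure" where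
  "schur_measure n k x y = point_measure (rect_partitions n k)
     (\<lambda>lam. ennreal (schur n lam x * schur k (conjugate lam) y
        / (\<Prod>i<n. \<Prod>j<k. 1 + x i * y j)))"

text \<open>With 1-based \<open>r = i + 1\<close> this is $a_r = \lambda_r - r + 1/2$.\<close>

definition half_pos :: "(nat \<Rightarrow> nat) \<Rightarrow> nat \<Rightarrow> real" where
  "half_pos lam i = real (lam i) - real (i + 1) + 1 / 2"

definition K_fun ::
  "nat \<Rightarrow> nat \<Rightarrow> (nat \<Rightarrow> real) \<Rightarrow> (nat \<Rightarrow> real) \<Rightarrow> complex \<Rightarrow> complex" where
  "K_fun n k x y z = (\<Prod>i<n. 1 / (1 - of_real (x i) * z)) * (\<Prod>j<k. 1 / (1 + of_real (y j) / z))"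

text \<open>The kernel is only meant for \<open>m, m' \<in> \<int> + 1/2\<close>. The factor $z^{-m}w^{m'}\sqrt{zw}$ is
  $z^{-m+1/2}w^{m'+1/2}$; the floors merely convert these exponents, which are integers, to type
  \<^typ>\<open>int\<close>. At poles of \<open>K\<close> on the \<open>w\<close>-contour, \<open>K w = 0\<close> and hence \<open>1 / K w = 0\<close> by the
  convention for division by zero, which is the correct value of the Laurent polynomial \<open>1 / K\<close>.\<close>

definition corr_kernel ::
  "nat \<Rightarrow> nat \<Rightarrow> (nat \<Rightarrow> real) \<Rightarrow> (nat \<Rightarrow> real) \<Rightarrow> (real \<Rightarrow> complex) \<Rightarrow> (real \<Rightarrow> complex) \<Rightarrow>
     real \<Rightarrow> real \<Rightarrow> complex" where
  "corr_kernel n k x y \<gamma>z \<gamma>w m m' =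
     contour_integral \<gamma>z (\<lambda>z. contour_integral \<gamma>w (\<lambda>w.
       1 / (2 * of_real pi * \<i> * z) * (1 / (2 * of_real pi * \<i> * w)) *
       (K_fun n k x y z / K_fun n k x y w) *
       (z powi \<lfloor>- m + 1 / 2\<rfloor> * w powi \<lfloor>m' + 1 / 2\<rfloor>) / (z - w)))"

definition pos_contour :: "(real \<Rightarrow> complex) \<Rightarrow> bool" where
  "pos_contour \<gamma> \<longleftrightarrow> valid_path \<gamma> \<and> simple_path \<gamma> \<and> pathfinish \<gamma> = pathstart \<gamma> \<and>
     (\<forall>p\<in>inside (path_image \<gamma>). winding_number \<gamma> p = 1)"

text \<open>If \<open>x i = 0\<close> then $x_i^{-1}$ is the point at infinity, which no contour contains.\<close>

definition admissible_contours ::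
  "nat \<Rightarrow> nat \<Rightarrow> (nat \<Rightarrow> real) \<Rightarrow> (nat \<Rightarrow> real) \<Rightarrow> (real \<Rightarrow> complex) \<Rightarrow> (real \<Rightarrow> complex) \<Rightarrow> bool" where
  "admissible_contours n k x y \<gamma>z \<gamma>w \<longleftrightarrow>
     pos_contour \<gamma>z \<and> pos_contour \<gamma>w \<and>
     (\<forall>j<k. - of_real (y j) \<in> inside (path_image \<gamma>z)) \<and>
     (\<forall>i<n. x i \<noteq> 0 \<longrightarrow> of_real (inverse (x i)) \<in> outside (path_image \<gamma>z)) \<and>
     0 \<in> inside (path_image \<gamma>w) \<and>
     path_image \<gamma>w \<subseteq> inside (path_image \<gamma>z) \<and>
     (\<forall>z\<in>path_image \<gamma>z. \<forall>w\<in>path_image \<gamma>w. norm w < norm z)"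

end

theory Submission
  imports Defs
begin

text \<open>
  Let \<open>l i = lam i - i\<close>. The \<open>w\<close>-integral picks finitely many terms of the Laurent polynomial
  \<open>1 / K(w)\<close>, and the \<open>z\<close>-integrals \<open>\<kappa>(s)\<close> of \<open>K(z) z^(-s-1)\<close> take the place of Laurent
  coefficients of \<open>K\<close> (there need not be an annulus on which \<open>K\<close> has a Laurent expansion). As
  all poles of \<open>1 / E(y; 1/z)\<close> lie inside the \<open>z\<close>-contour, the kernel matrix collapses to a product
  of three \<open>n \<times> n\<close> matrices: \<open>\<kappa>(l i + a)\<close>, a unitriangular one, and \<open>e_(l j + b)(y)\<close>.
  By the dual Jacobi-Trudi formula the last determinant is \<open>s_lam'(y)\<close>. Removing one factor
  \<open>1 / (1 + y_j/z)\<close> from \<open>K\<close> applies \<open>1 + y_j S\<close> to the columns of the first matrix, where \<open>S\<close>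
  is the shift; in a suitable basis \<open>S\<close> is bidiagonal with eigenvalues \<open>x_i\<close>, so the
  determinant is multiplied by \<open>\<Prod>i. 1 + x_i y_j\<close>, and without these factors it is the
  Jacobi-Trudi determinant of \<open>s_lam(x)\<close>. The same shift gives the Pieri rule and hence, by
  induction on \<open>k\<close>, the total mass.
\<close>

section \<open>Determinants of matrices given by their entries\<close>

text \<open>Entry functions on all of \<open>nat\<close> keep dimension side conditions out of the
  calculations; only indices below \<open>n\<close> count.\<close>

definition fdet :: "nat \<Rightarrow> (nat \<Rightarrow> nat \<Rightarrow> 'a::comm_ring_1) \<Rightarrow> 'a" where
  "fdet n A = Determinant.det (Matrix.mat n n (\<lambda>(i, j). A i j))"

lemma fdet_Leibniz:
  "fdet n A = (\<Sum>p | p permutes {..<n}. signof p * (\<Prod>i<n. A i (p i)))"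
proof -
  have "fdet n A = (\<Sum>p | p permutes {0..<n}.
      signof p * (\<Prod>i = 0..<n. Matrix.mat n n (\<lambda>(i, j). A i j) $$ (i, p i)))"
    unfolding fdet_def by (rule det_def') simp
  also have "\<dots> = (\<Sum>p | p permutes {0..<n}. signof p * (\<Prod>i = 0..<n. A i (p i)))"
  proof (intro sum.cong refl arg_cong2[where f = "(*)"] prod.cong)
    fix p i assume "p \<in> {p. p permutes {0..<n}}" "i \<in> {0..<n}"
    moreover from this have "p i < n"
      using permutes_in_image[of p "{0..<n}" i] by auto
    ultimately show "Matrix.mat n n (\<lambda>(i, j). A i j) $$ (i, p i) = A i (p i)" by simp
  qed
  finally show ?thesis by (simp add: atLeast0LessThan)
qed

lemma fdet_cong:
  "(\<And>i j. i < n \<Longrightarrow> j < n \<Longrightarrow> A i j = B i j) \<Longrightarrow> fdet n A = fdet n B"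
  unfolding fdet_def by (intro arg_cong[where f = Determinant.det] eq_matI) auto

lemma fdet_mult:
  "fdet n (\<lambda>i j. \<Sum>t<n. A i t * B t j) = fdet n A * fdet n B"
proof -
  have "Matrix.mat n n (\<lambda>(i, j). \<Sum>t<n. A i t * B t j) =
      Matrix.mat n n (\<lambda>(i, j). A i j) * Matrix.mat n n (\<lambda>(i, j). B i j)"
    by (rule eq_matI) (auto simp: scalar_prod_def atLeast0LessThan)
  then show ?thesis unfolding fdet_def by (simp add: det_mult[of _ n])
qed

lemma fdet_transpose: "fdet n (\<lambda>i j. A j i) = fdet n A"
proof -
  have "Matrix.mat n n (\<lambda>(i, j). A j i) = transpose_mat (Matrix.mat n n (\<lambda>(i, j). A i j))"
    by (rule eq_matI) auto
  then show ?thesis unfolding fdet_def by (simp add: Determinant.det_transpose[of _ n])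
qed

lemma fdet_lower_triangular:
  assumes "\<And>i j. i < j \<Longrightarrow> j < n \<Longrightarrow> A i j = 0"
  shows "fdet n A = (\<Prod>i<n. A i i)"
  unfolding fdet_def
  by (subst det_lower_triangular[of n]) (auto simp: assms prod_list_diag_prod atLeast0LessThan)

lemma fdet_upper_triangular:
  assumes "\<And>i j. j < i \<Longrightarrow> i < n \<Longrightarrow> A i j = 0"
  shows "fdet n A = (\<Prod>i<n. A i i)"
  using fdet_lower_triangular[of n "\<lambda>i j. A j i"] assms fdet_transpose[of n A] by simp

lemma fdet_equal_rows:
  assumes "i < n" "i' < n" "i \<noteq> i'" "\<And>j. j < n \<Longrightarrow> A i j = A i' j"
  shows "fdet n A = 0"
  unfolding fdet_def using assms
  by (intro Determinant.det_identical_rows[of _ n i i']) (auto intro!: eq_vecI)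

lemma fdet_zero_row:
  assumes "i < n" "\<And>j. j < n \<Longrightarrow> A i j = 0"
  shows "fdet n A = 0"
proof -
  have "(\<Prod>r<n. A r (p r)) = 0" if "p permutes {..<n}" for p
    using that assms permutes_in_image[of p "{..<n}" i] by (intro prod_zero) auto
  then show ?thesis by (simp add: fdet_Leibniz)
qed

text \<open>Choice functions are extended by \<open>0\<close>, so that partitions with at most \<open>n\<close> parts can be
  used as summation indices.\<close>

definition choices :: "nat \<Rightarrow> (nat \<Rightarrow> nat set) \<Rightarrow> (nat \<Rightarrow> nat) set" where
  "choices n B = {g. (\<forall>i<n. g i \<in> B i) \<and> (\<forall>i\<ge>n. g i = 0)}"

lemma bij_betw_choices:
  "bij_betw (\<lambda>g i. if i < n then g i else 0) (PiE {..<n} B) (choices n B)"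
  by (rule bij_betw_byWitness[where f' = "\<lambda>g. restrict g {..<n}"])
    (auto simp: choices_def PiE_def extensional_def restrict_def fun_eq_iff)

lemma finite_choices:
  assumes "\<And>i. i < n \<Longrightarrow> finite (B i)"
  shows "finite (choices n B)"
  using bij_betw_finite[OF bij_betw_choices[of n B]] finite_PiE[of "{..<n}" B] assms by auto

lemma prod_sum_choices:
  fixes f :: "nat \<Rightarrow> nat \<Rightarrow> 'a::comm_semiring_1"
  assumes "\<And>i. i < n \<Longrightarrow> finite (B i)"
  shows "(\<Prod>i<n. \<Sum>t\<in>B i. f i t) = (\<Sum>g\<in>choices n B. \<Prod>i<n. f i (g i))"
proof -
  have "(\<Prod>i<n. \<Sum>t\<in>B i. f i t) = (\<Sum>g\<in>PiE {..<n} B. \<Prod>i<n. f i (g i))"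
    by (rule prod_sum_PiE) (use assms in auto)
  also have "\<dots> = (\<Sum>g\<in>PiE {..<n} B. \<Prod>i<n. f i (if i < n then g i else 0))"
    by simp
  also have "\<dots> = (\<Sum>g\<in>choices n B. \<Prod>i<n. f i (g i))"
    by (rule sum.reindex_bij_betw[OF bij_betw_choices])
  finally show ?thesis .
qed

text \<open>Multilinearity in the rows: expanding picks one term of the sum in each row. The
  branching rules and the Pieri rule all rest on this expansion.\<close>

lemma fdet_sum_rows:
  fixes A :: "nat \<Rightarrow> nat \<Rightarrow> nat \<Rightarrow> 'a::comm_ring_1"
  assumes "\<And>i. i < n \<Longrightarrow> finite (B i)"
  shows "fdet n (\<lambda>i j. \<Sum>t\<in>B i. c i t * A i t j) =
    (\<Sum>g\<in>choices n B. (\<Prod>i<n. c i (g i)) * fdet n (\<lambda>i j. A i (g i) j))"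
proof -
  have "fdet n (\<lambda>i j. \<Sum>t\<in>B i. c i t * A i t j) =
      (\<Sum>p | p permutes {..<n}. \<Sum>g\<in>choices n B.
        signof p * (\<Prod>i<n. c i (g i) * A i (g i) (p i)))"
    by (simp add: fdet_Leibniz prod_sum_choices[OF assms] sum_distrib_left)
  also have "\<dots> = (\<Sum>g\<in>choices n B. \<Sum>p | p permutes {..<n}.
        signof p * (\<Prod>i<n. c i (g i) * A i (g i) (p i)))"
    by (rule sum.swap)
  also have "\<dots> = (\<Sum>g\<in>choices n B. (\<Prod>i<n. c i (g i)) * fdet n (\<lambda>i j. A i (g i) j))"
    by (simp add: fdet_Leibniz sum_distrib_left prod.distrib mult_ac)
  finally show ?thesis .
qed

section \<open>Complete and elementary symmetric polynomials\<close>

text \<open>The complete homogeneous polynomial h_s in the first \<open>m\<close> variables. The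
  integer index serves Jacobi-Trudi entries: for negative \<open>s\<close>, \<open>nat s = 0\<close>
  leaves only the term \<open>r = 0\<close>, and the value is 0.\<close>

primrec hs :: "(nat \<Rightarrow> 'a::comm_semiring_1) \<Rightarrow> nat \<Rightarrow> int \<Rightarrow> 'a" where
  "hs x 0 s = of_bool (s = 0)"
| "hs x (Suc m) s = (\<Sum>r\<le>nat s. x m ^ r * hs x m (s - int r))"

primrec es :: "(nat \<Rightarrow> 'a::comm_semiring_1) \<Rightarrow> nat \<Rightarrow> int \<Rightarrow> 'a" where
  "es x 0 s = of_bool (s = 0)"
| "es x (Suc m) s = es x m s + x m * es x m (s - 1)"

lemma hs_neg: "s < 0 \<Longrightarrow> hs x m s = 0"
  by (induction m arbitrary: s) auto

lemma hs_rec: "hs x (Suc m) s = hs x m s + x m * hs x (Suc m) (s - 1)"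
proof (cases "s > 0")
  case True
  then have "nat s = Suc (nat (s - 1))" by simp
  then show ?thesis
    by (simp add: sum.atMost_Suc_shift sum_distrib_left mult_ac algebra_simps del: sum.atMost_Suc)
next
  case False
  then show ?thesis by (cases "s = 0") (simp_all add: hs_neg)
qed

declare hs.simps(2) [simp del]

text \<open>This is \<open>hs_rec\<close> iterated \<open>d\<close> times. In
  \<open>jt_h_rec\<close> the left side is an entry of a row minus a multiple of the next
  row.\<close>

lemma hs_telescope:
  fixes x :: "nat \<Rightarrow> 'a::comm_ring_1"
  shows "hs x (Suc m) s - x m ^ d * hs x (Suc m) (s - int d) =
    (\<Sum>r<d. x m ^ r * hs x m (s - int r))"
proof (induction d)
  case (Suc d)
  have "s - int d - 1 = s - int (Suc d)" by simp
  with hs_rec[of x m "s - int d"] Suc show ?case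
    by (simp add: algebra_simps)
qed simp

lemma es_neg: "s < 0 \<Longrightarrow> es x m s = 0"
  by (induction m arbitrary: s) auto

lemma es_zero [simp]: "es x m 0 = 1"
  by (induction m) (auto simp: es_neg)

lemma es_gt: "s > int m \<Longrightarrow> es x m s = 0"
  by (induction m arbitrary: s) auto

text \<open>With \<open>D\<close> lowering the argument by one, \<open>f a\<close> arises from
  \<open>f 0\<close> by the product of the operators \<open>1 + c i * D\<close> with
  \<open>i < a\<close>; expanding it yields the elementary symmetric polynomials in these
  \<open>c i\<close>.\<close>

lemma es_expand:
  fixes f :: "nat \<Rightarrow> int \<Rightarrow> 'a::comm_semiring_1"
  assumes "\<And>a s. a < n \<Longrightarrow> f (Suc a) s = f a s + c a * f a (s - 1)"
  shows "a \<le> n \<Longrightarrow> f a s = (\<Sum>r\<le>a. es c a (int r) * f 0 (s - int r))"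
proof (induction a arbitrary: s)
  case (Suc a)
  have "(\<Sum>r\<le>Suc a. es c a (int r) * f 0 (s - int r)) =
      (\<Sum>r\<le>a. es c a (int r) * f 0 (s - int r))"
    by (simp add: es_gt)
  moreover have "(\<Sum>r\<le>Suc a. es c a (int r - 1) * f 0 (s - int r)) =
      (\<Sum>r\<le>a. es c a (int r) * f 0 (s - 1 - int r))"
    by (subst sum.atMost_Suc_shift) (simp add: es_neg algebra_simps)
  ultimately show ?case
    using Suc assms[of a s]
    by (simp add: distrib_right sum.distrib mult.assoc flip: sum_distrib_left
        del: sum.atMost_Suc)
qed simp

text \<open>Lowering the argument \<open>l i + a\<close> by \<open>r\<close> leads to column
  \<open>a - r\<close>. By \<open>es_expand\<close> each new column is therefore the old one plus a
  combination of earlier ones, a unitriangular change of basis.\<close>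

lemma fdet_Newton_basis:
  fixes f :: "nat \<Rightarrow> int \<Rightarrow> 'a::comm_ring_1"
  assumes "\<And>a s. a < n \<Longrightarrow> f (Suc a) s = f a s + c a * f a (s - 1)"
  shows "fdet n (\<lambda>i a. f a (l i + int a)) = fdet n (\<lambda>i a. f 0 (l i + int a))"
proof -
  have "fdet n (\<lambda>i a. f a (l i + int a)) =
      fdet n (\<lambda>i a. \<Sum>t<n. f 0 (l i + int t) * es c a (int a - int t))"
  proof (rule fdet_cong)
    fix i a assume "a < n"
    have "(\<Sum>t<n. f 0 (l i + int t) * es c a (int a - int t)) =
        (\<Sum>t\<le>a. f 0 (l i + int t) * es c a (int a - int t))"
      using \<open>a < n\<close> by (intro sum.mono_neutral_right) (auto simp: es_neg)
    also have "\<dots> = (\<Sum>r\<le>a. es c a (int r) * f 0 (l i + int a - int r))"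
      by (rule sum.reindex_bij_witness[of _ "\<lambda>r. a - r" "\<lambda>t. a - t"])
        (auto simp: of_nat_diff mult.commute)
    also have "\<dots> = f a (l i + int a)"
      using es_expand[where f = f and c = c and n = n and a = a and s = "l i + int a", OF assms]
        \<open>a < n\<close> by simp
    finally show "f a (l i + int a) = (\<Sum>t<n. f 0 (l i + int t) * es c a (int a - int t))" ..
  qed
  also have "\<dots> = fdet n (\<lambda>i a. f 0 (l i + int a))"
    by (simp add: fdet_mult fdet_upper_triangular[of n "\<lambda>t a. es c a (int a - int t)"] es_neg)
  finally show ?thesis .
qed

text \<open>In the basis \<open>f a (l + a)\<close> of the columns, the shift \<open>l \<mapsto> l + 1\<close> is bidiagonal with
  diagonal entries \<open>- c a\<close>.\<close>

lemma fdet_shift: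
  fixes f :: "nat \<Rightarrow> int \<Rightarrow> 'a::comm_ring_1"
  assumes step: "\<And>a s. a < n \<Longrightarrow> f (Suc a) s = f a s + c a * f a (s - 1)"
    and vanish: "\<And>s. s \<ge> 1 \<Longrightarrow> f n s = 0"
    and l: "\<And>i. i < n \<Longrightarrow> l i \<ge> 1 - int n"
  shows "fdet n (\<lambda>i j. f 0 (l i + int j) + y * f 0 (l i + int j + 1)) =
    (\<Prod>a<n. 1 - c a * y) * fdet n (\<lambda>i j. f 0 (l i + int j))"
proof -
  define h where "h a s = f a s + y * f a (s + 1)" for a s
  \<comment> \<open>The matrix of \<open>1 + y * shift\<close> in the columns
    \<open>f t (l + t)\<close>: \<open>step\<close> at \<open>s = l + a + 1\<close> reads
    \<open>f a (l + a + 1) = f (Suc a) (l + Suc a) - c a * f a (l + a)\<close>.\<close>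
  define N where "N t a = (if t = a then 1 - c a * y else if t = Suc a then y else 0)" for t a
  have h_step: "h (Suc a) s = h a s + c a * h a (s - 1)" if "a < n" for a s
    unfolding h_def using step[OF that, of s] step[OF that, of "s + 1"]
    by (simp add: algebra_simps)
  have "fdet n (\<lambda>i j. h 0 (l i + int j)) = fdet n (\<lambda>i a. h a (l i + int a))"
    using fdet_Newton_basis[of n h c l] h_step by simp
  also have "\<dots> = fdet n (\<lambda>i a. \<Sum>t<n. f t (l i + int t) * N t a)"
  proof (rule fdet_cong)
    fix i a assume "i < n" "a < n"
    \<comment> \<open>For \<open>a = n - 1\<close> the bidiagonal matrix reaches column
      \<open>n\<close>, which vanishes since \<open>l i + n \<ge> 1\<close>.\<close>
    have "(\<Sum>t<n. f t (l i + int t) * N t a) = (\<Sum>t\<le>n. f t (l i + int t) * N t a)"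
      using vanish[of "l i + int n"] l[OF \<open>i < n\<close>] by (simp add: lessThan_Suc_atMost[symmetric])
    also have "\<dots> = (\<Sum>t\<in>{a, Suc a}. f t (l i + int t) * N t a)"
      using \<open>a < n\<close> by (intro sum.mono_neutral_right) (auto simp: N_def)
    also have "\<dots> = h a (l i + int a)"
      using step[OF \<open>a < n\<close>, of "l i + int (Suc a)"]
      by (simp add: N_def h_def algebra_simps)
    finally show "h a (l i + int a) = (\<Sum>t<n. f t (l i + int t) * N t a)" ..
  qed
  also have "\<dots> = fdet n (\<lambda>i j. f j (l i + int j)) * fdet n N"
    by (rule fdet_mult)
  also have "fdet n N = (\<Prod>a<n. N a a)"
    by (rule fdet_lower_triangular) (auto simp: N_def)
  also have "fdet n (\<lambda>i j. f j (l i + int j)) = fdet n (\<lambda>i j. f 0 (l i + int j))"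
    by (rule fdet_Newton_basis[of n f c l]) (use step in auto)
  finally show ?thesis by (simp add: h_def N_def mult.commute)
qed

section \<open>Branching and Pieri rules for Jacobi-Trudi determinants\<close>

definition parts :: "nat \<Rightarrow> (nat \<Rightarrow> nat) set" where
  "parts n = {lam. antimono lam \<and> (\<forall>i\<ge>n. lam i = 0)}"

text \<open>The integer \<open>half_pos lam i + 1 / 2\<close>.\<close>

abbreviation pos :: "(nat \<Rightarrow> nat) \<Rightarrow> nat \<Rightarrow> int" where
  "pos lam i \<equiv> int (lam i) - int i"

text \<open>Interlacing: for partitions it says that \<open>lam\<close> minus \<open>mu\<close> has
  at most one cell in each column, a horizontal strip. The vertical strips below have at most one
  cell in each row.\<close>

definition hstrip :: "(nat \<Rightarrow> nat) \<Rightarrow> (nat \<Rightarrow> nat) \<Rightarrow> bool" where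
  "hstrip mu lam \<longleftrightarrow> (\<forall>i. lam (Suc i) \<le> mu i \<and> mu i \<le> lam i)"

definition vstrip :: "(nat \<Rightarrow> nat) \<Rightarrow> (nat \<Rightarrow> nat) \<Rightarrow> bool" where
  "vstrip mu lam \<longleftrightarrow> (\<forall>i. mu i \<le> lam i \<and> lam i \<le> Suc (mu i))"

definition jt_h :: "nat \<Rightarrow> (nat \<Rightarrow> 'a::comm_ring_1) \<Rightarrow> nat \<Rightarrow> (nat \<Rightarrow> nat) \<Rightarrow> 'a" where
  "jt_h n x m lam = fdet n (\<lambda>i j. hs x m (pos lam i + int j))"

text \<open>The dual Jacobi-Trudi determinant, belonging to the conjugate of \<open>lam\<close>. The
  size \<open>n\<close> is separate from the number \<open>m\<close> of variables, so that
  inductions on \<open>m\<close> keep the matrix size.\<close>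

definition jt_e :: "nat \<Rightarrow> (nat \<Rightarrow> 'a::comm_ring_1) \<Rightarrow> nat \<Rightarrow> (nat \<Rightarrow> nat) \<Rightarrow> 'a" where
  "jt_e n y m lam = fdet n (\<lambda>i j. es y m (pos lam i + int j))"

lemma antimono_Suc: "antimono lam \<Longrightarrow> lam (Suc i) \<le> (lam i :: nat)"
  by (simp add: antimonoD)

lemma partsI:
  "(\<And>i. lam (Suc i) \<le> lam i) \<Longrightarrow> (\<And>i. i \<ge> n \<Longrightarrow> lam i = 0) \<Longrightarrow> lam \<in> parts n"
  by (simp add: parts_def antimono_iff_le_Suc)

text \<open>The intervals for consecutive \<open>i\<close> meet at \<open>lam (Suc i)\<close>, so
  independent choices in them are automatically weakly decreasing.\<close>

lemma hstrips_eq_choices: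
  assumes "lam \<in> parts n"
  shows "{mu \<in> parts n. hstrip mu lam} = choices n (\<lambda>i. {lam (Suc i)..lam i})"
proof safe
  fix mu assume mu: "mu \<in> choices n (\<lambda>i. {lam (Suc i)..lam i})"
  have "lam (Suc i) \<le> mu i \<and> mu i \<le> lam i" for i
    using mu assms by (cases "i < n") (auto simp: choices_def parts_def)
  then show "hstrip mu lam" unfolding hstrip_def by blast
  then show "mu \<in> parts n" using mu
    by (intro partsI) (auto simp: choices_def hstrip_def intro: order_trans)
qed (auto simp: choices_def hstrip_def parts_def)

text \<open>Subtract from each row the next one times the power of \<open>x m\<close> given by the
  difference of their positions. By \<open>hs_telescope\<close> the variable \<open>x m\<close>
  leaves the entries, and the terms of row \<open>i\<close> are indexed by the possible values of
  \<open>mu i\<close>.\<close>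

lemma jt_h_rec:
  fixes x :: "nat \<Rightarrow> 'a::comm_ring_1"
  assumes "lam \<in> parts n"
  shows "jt_h n x (Suc m) lam =
    (\<Sum>mu | mu \<in> parts n \<and> hstrip mu lam. (\<Prod>i<n. x m ^ (lam i - mu i)) * jt_h n x m mu)"
proof -
  define U where "U i j = hs x (Suc m) (pos lam i + int j)" for i j
  define L where "L i t = (if t = i then 1 else if t = Suc i
    then - (x m ^ (lam i - lam (Suc i) + 1)) else 0)" for i t
  have dec: "lam (Suc i) \<le> lam i" for i
    using assms by (simp add: parts_def antimono_Suc)
  have "fdet n U = fdet n L * fdet n U"
    by (subst fdet_upper_triangular[of n L]) (auto simp: L_def)
  also have "\<dots> = fdet n (\<lambda>i j. \<Sum>t<n. L i t * U t j)"
    by (simp add: fdet_mult)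
  also have "\<dots> = fdet n (\<lambda>i j. \<Sum>t\<in>{lam (Suc i)..lam i}.
      x m ^ (lam i - t) * hs x m (int t - int i + int j))"
  proof (rule fdet_cong)
    fix i j assume "i < n" "j < n"
    define d where "d = lam i - lam (Suc i) + 1"
    have d: "int d = int (lam i) - int (lam (Suc i)) + 1"
      using dec[of i] by (simp add: d_def of_nat_diff)
    \<comment> \<open>Row \<open>n\<close> may be added: \<open>lam n = 0\<close>, so its entries
      have index \<open>j - n < 0\<close>.\<close>
    have "(\<Sum>t<n. L i t * U t j) = (\<Sum>t\<le>n. L i t * U t j)"
      using \<open>j < n\<close> assms
      by (simp add: lessThan_Suc_atMost[symmetric] U_def hs_neg parts_def)
    also have "\<dots> = (\<Sum>t\<in>{i, Suc i}. L i t * U t j)"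
      using \<open>i < n\<close> by (intro sum.mono_neutral_right) (auto simp: L_def)
    also have "\<dots> = U i j - x m ^ d * U (Suc i) j"
      by (simp add: L_def d_def)
    also have "U (Suc i) j = hs x (Suc m) (pos lam i + int j - int d)"
      by (simp add: U_def d algebra_simps)
    also have "U i j - x m ^ d * \<dots> = (\<Sum>r<d. x m ^ r * hs x m (pos lam i + int j - int r))"
      unfolding U_def by (rule hs_telescope)
    also have "\<dots> = (\<Sum>t\<in>{lam (Suc i)..lam i}.
        x m ^ (lam i - t) * hs x m (int t - int i + int j))"
      by (rule sum.reindex_bij_witness[of _ "\<lambda>t. lam i - t" "\<lambda>r. lam i - r"])
        (use dec[of i] in \<open>auto simp: d_def of_nat_diff algebra_simps\<close>)
    finally show "(\<Sum>t<n. L i t * U t j) = (\<Sum>t\<in>{lam (Suc i)..lam i}.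
        x m ^ (lam i - t) * hs x m (int t - int i + int j))" .
  qed
  also have "\<dots> = (\<Sum>mu\<in>choices n (\<lambda>i. {lam (Suc i)..lam i}).
      (\<Prod>i<n. x m ^ (lam i - mu i)) * fdet n (\<lambda>i j. hs x m (pos mu i + int j)))"
    by (rule fdet_sum_rows) simp
  finally show ?thesis
    by (simp add: hstrips_eq_choices[OF assms] jt_h_def U_def[abs_def])
qed

text \<open>A choice for which \<open>lam - g\<close> is not a partition gives two equal rows or a zero last row.\<close>

lemma jt_e_rec:
  fixes y :: "nat \<Rightarrow> 'a::comm_ring_1"
  assumes "lam \<in> parts n"
  shows "jt_e n y (Suc m) lam =
    (\<Sum>mu | mu \<in> parts n \<and> vstrip mu lam. (\<Prod>i<n. y m ^ (lam i - mu i)) * jt_e n y m mu)"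
proof -
  let ?G = "choices n (\<lambda>_. {0, 1})"
  define F where "F g = (\<Prod>i<n. y m ^ g i) *
    fdet n (\<lambda>i j. es y m (pos lam i - int (g i) + int j))" for g
  define nu where "nu g i = int (lam i) - int (g i)" for g i
  have dec: "lam (Suc i) \<le> lam i" for i
    using assms by (simp add: parts_def antimono_Suc)
  have "jt_e n y (Suc m) lam =
      fdet n (\<lambda>i j. \<Sum>t\<in>{0, 1}. y m ^ t * es y m (pos lam i - int t + int j))"
    unfolding jt_e_def by (rule fdet_cong) (simp add: algebra_simps)
  also have "\<dots> = (\<Sum>g\<in>?G. F g)"
    unfolding F_def by (rule fdet_sum_rows) simp
  \<comment> \<open>Integer values of \<open>nu\<close> avoid truncated subtraction. Since
    \<open>nu g n = 0\<close>, the condition at \<open>i = n - 1\<close> excludes a negative last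
    part.\<close>
  also have "\<dots> = (\<Sum>g | g \<in> ?G \<and> (\<forall>i<n. nu g (Suc i) \<le> nu g i). F g)"
  proof (rule sum.mono_neutral_right)
    show "finite ?G" by (rule finite_choices) simp
    show "\<forall>g\<in>?G - {g \<in> ?G. \<forall>i<n. nu g (Suc i) \<le> nu g i}. F g = 0"
    proof
      fix g assume "g \<in> ?G - {g \<in> ?G. \<forall>i<n. nu g (Suc i) \<le> nu g i}"
      then obtain i where g: "g \<in> ?G" and i: "i < n" "nu g i < nu g (Suc i)"
        by (auto simp: not_le)
      have g01: "g i \<le> 1" using g i(1) by (auto simp: choices_def)
      have eq: "lam (Suc i) = lam i" "g i = 1" "g (Suc i) = 0"
        using dec[of i] i g01 by (auto simp: nu_def)
      have "fdet n (\<lambda>i j. es y m (pos lam i - int (g i) + int j)) = 0"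
      proof (cases "Suc i < n")
        case True
        then show ?thesis using eq by (intro fdet_equal_rows[of i n "Suc i"]) (auto simp: algebra_simps)
      next
        case False
        then have "lam i = 0" using eq assms i by (auto simp: parts_def)
        then show ?thesis using False i eq
          by (intro fdet_zero_row[of i]) (auto intro!: es_neg)
      qed
      then show "F g = 0" by (simp add: F_def)
    qed
  qed auto
  also have "\<dots> = (\<Sum>mu | mu \<in> parts n \<and> vstrip mu lam.
      (\<Prod>i<n. y m ^ (lam i - mu i)) * jt_e n y m mu)"
  proof (rule sum.reindex_bij_witness[of _ "\<lambda>mu i. lam i - mu i" "\<lambda>g i. lam i - g i"])
    fix g assume g: "g \<in> {g. g \<in> ?G \<and> (\<forall>i<n. nu g (Suc i) \<le> nu g i)}"
    have nu_out: "nu g i = 0" if "i \<ge> n" for i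
      using that g assms by (auto simp: nu_def choices_def parts_def)
    have "nu g (Suc i) \<le> nu g i" for i
      using g nu_out[of i] nu_out[of "Suc i"] by (cases "i < n") auto
    then have nu_anti: "antimono (nu g)" by (simp add: antimono_iff_le_Suc)
    have "nu g i \<ge> 0" for i
      using antimonoD[OF nu_anti, of i "max i n"] nu_out[of "max i n"] by simp
    then have le: "g i \<le> lam i" for i by (simp add: nu_def)
    have g1: "g i \<le> 1" for i using g by (cases "i < n") (auto simp: choices_def)
    show "(\<lambda>i. lam i - (lam i - g i)) = g" using le by auto
    show "(\<lambda>i. lam i - g i) \<in> {mu \<in> parts n. vstrip mu lam}"
    proof safe
      show "(\<lambda>i. lam i - g i) \<in> parts n"
      proof (rule partsI)
        show "lam (Suc i) - g (Suc i) \<le> lam i - g i" for i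
          using antimonoD[OF nu_anti, of i "Suc i"] le[of i] le[of "Suc i"]
          by (simp add: nu_def of_nat_diff)
      qed (use assms in \<open>simp add: parts_def\<close>)
      show "vstrip (\<lambda>i. lam i - g i) lam"
        unfolding vstrip_def
      proof
        show "lam i - g i \<le> lam i \<and> lam i \<le> Suc (lam i - g i)" for i
          using le[of i] g1[of i] by auto
      qed
    qed
    show "(\<Prod>i<n. y m ^ (lam i - (lam i - g i))) * jt_e n y m (\<lambda>i. lam i - g i) = F g"
      using le by (simp add: F_def jt_e_def of_nat_diff algebra_simps)
  next
    fix mu assume mu: "mu \<in> {mu \<in> parts n. vstrip mu lam}"
    then have le: "mu i \<le> lam i" "lam i \<le> Suc (mu i)" for i by (auto simp: vstrip_def)
    show "(\<lambda>i. lam i - (lam i - mu i)) = mu" using le by auto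
    have "lam i - mu i = 0 \<or> lam i - mu i = 1" for i using le[of i] by auto
    then show "(\<lambda>i. lam i - mu i) \<in> {g. g \<in> ?G \<and> (\<forall>i<n. nu g (Suc i) \<le> nu g i)}"
      using mu assms le by (auto simp: choices_def nu_def parts_def antimono_Suc of_nat_diff)
  qed
  finally show ?thesis .
qed

text \<open>Expand the rows of the determinant with entries \<open>h_s + y * h_(s + 1)\<close>.
  Choices that do not give a partition produce equal rows, the others are the vertical strips, and
  \<open>fdet_shift\<close> evaluates the determinant as a whole.\<close>

lemma Pieri_jt_h:
  fixes x :: "nat \<Rightarrow> 'a::comm_ring_1"
  assumes "mu \<in> parts n"
  shows "(\<Sum>lam | lam \<in> parts n \<and> vstrip mu lam. (\<Prod>i<n. y ^ (lam i - mu i)) * jt_h n x n lam) =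
    (\<Prod>i<n. 1 + x i * y) * jt_h n x n mu"
proof -
  let ?G = "choices n (\<lambda>_. {0, 1})"
  define F where "F g = (\<Prod>i<n. y ^ g i) *
    fdet n (\<lambda>i j. hs x n (pos mu i + int (g i) + int j))" for g
  have dec: "mu (Suc i) \<le> mu i" for i
    using assms by (simp add: parts_def antimono_Suc)
  have "(\<Sum>lam | lam \<in> parts n \<and> vstrip mu lam. (\<Prod>i<n. y ^ (lam i - mu i)) * jt_h n x n lam) =
      (\<Sum>g | g \<in> ?G \<and> (\<forall>i. mu (Suc i) + g (Suc i) \<le> mu i + g i). F g)"
  proof (rule sum.reindex_bij_witness[of _ "\<lambda>g i. mu i + g i" "\<lambda>lam i. lam i - mu i"])
    fix lam assume lam: "lam \<in> {lam \<in> parts n. vstrip mu lam}"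
    then have le: "mu i \<le> lam i" "lam i \<le> Suc (mu i)" for i by (auto simp: vstrip_def)
    show "(\<lambda>i. mu i + (lam i - mu i)) = lam" using le by auto
    have "lam i - mu i = 0 \<or> lam i - mu i = 1" for i using le[of i] by auto
    then show "(\<lambda>i. lam i - mu i) \<in> {g. g \<in> ?G \<and> (\<forall>i. mu (Suc i) + g (Suc i) \<le> mu i + g i)}"
      using lam assms le by (auto simp: choices_def parts_def antimono_Suc)
    show "F (\<lambda>i. lam i - mu i) = (\<Prod>i<n. y ^ (lam i - mu i)) * jt_h n x n lam"
      using le by (simp add: F_def jt_h_def of_nat_diff algebra_simps)
  next
    fix g assume g: "g \<in> {g. g \<in> ?G \<and> (\<forall>i. mu (Suc i) + g (Suc i) \<le> mu i + g i)}"
    have "g i \<le> 1" for i using g by (cases "i < n") (auto simp: choices_def)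
    then show "(\<lambda>i. mu i + g i) \<in> {lam \<in> parts n. vstrip mu lam}"
      using g assms by (auto simp: vstrip_def choices_def parts_def antimono_iff_le_Suc)
  qed auto
  also have "\<dots> = (\<Sum>g\<in>?G. F g)"
  proof (rule sum.mono_neutral_left)
    show "finite ?G" by (rule finite_choices) simp
    show "\<forall>g\<in>?G - {g \<in> ?G. \<forall>i. mu (Suc i) + g (Suc i) \<le> mu i + g i}. F g = 0"
    proof
      fix g assume "g \<in> ?G - {g \<in> ?G. \<forall>i. mu (Suc i) + g (Suc i) \<le> mu i + g i}"
      then obtain i where g: "g \<in> ?G" and i: "mu i + g i < mu (Suc i) + g (Suc i)"
        by (auto simp: not_le)
      have "Suc i < n"
        using i g assms by (cases "Suc i < n") (auto simp: choices_def parts_def)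
      moreover have "g (Suc i) \<le> 1" using g \<open>Suc i < n\<close> by (auto simp: choices_def)
      with dec[of i] i have "mu (Suc i) = mu i" "g i = 0" "g (Suc i) = 1" by auto
      ultimately have "fdet n (\<lambda>i j. hs x n (pos mu i + int (g i) + int j)) = 0"
        by (intro fdet_equal_rows[of i n "Suc i"]) auto
      then show "F g = 0" by (simp add: F_def)
    qed
  qed auto
  also have "\<dots> = fdet n (\<lambda>i j. \<Sum>t\<in>{0, 1}. y ^ t * hs x n (pos mu i + int t + int j))"
    unfolding F_def by (rule fdet_sum_rows[symmetric]) simp
  also have "\<dots> = fdet n (\<lambda>i j. hs x (n - 0) (pos mu i + int j) +
      y * hs x (n - 0) (pos mu i + int j + 1))"
    by (rule fdet_cong) (simp add: algebra_simps)
  also have "\<dots> = (\<Prod>a<n. 1 - (- x (n - Suc a)) * y) *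
      fdet n (\<lambda>i j. hs x (n - 0) (pos mu i + int j))"
  \<comment> \<open>Removing variables from the last one on gives the family for the shift. Its end
    \<open>hs x 0\<close> is zero for \<open>s \<ge> 1\<close>, as required.\<close>
  proof (rule fdet_shift[where f = "\<lambda>a. hs x (n - a)"])
    show "hs x (n - Suc a) s = hs x (n - a) s + - x (n - Suc a) * hs x (n - a) (s - 1)"
      if "a < n" for a s
      using hs_rec[of x "n - Suc a" s] that by (simp add: Suc_diff_Suc)
  qed auto
  also have "(\<Prod>a<n. 1 - (- x (n - Suc a)) * y) = (\<Prod>i<n. 1 + x i * y)"
    using prod.nat_diff_reindex[of "\<lambda>i. 1 + x i * y" n] by simp
  finally show ?thesis by (simp add: jt_h_def)
qed

section \<open>Tableaux and the Jacobi-Trudi formulas\<close>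

lemma parts_antimono: "lam \<in> parts n \<Longrightarrow> i \<le> i' \<Longrightarrow> lam i' \<le> lam i"
  by (simp add: parts_def antimonoD)

text \<open>The relations along rows and down columns are parameters, so that one recursion serves
  both semistandard tableaux and their transposes.\<close>

definition tableaux ::
  "(nat \<Rightarrow> nat \<Rightarrow> bool) \<Rightarrow> (nat \<Rightarrow> nat \<Rightarrow> bool) \<Rightarrow> nat \<Rightarrow> (nat \<Rightarrow> nat) \<Rightarrow> (nat \<times> nat \<Rightarrow> nat) set" where
  "tableaux R C m lam = {T \<in> diagram lam \<rightarrow>\<^sub>E {..<m}.
     (\<forall>i j j'. j < j' \<and> (i, j') \<in> diagram lam \<longrightarrow> R (T (i, j)) (T (i, j'))) \<and>
     (\<forall>i i' j. i < i' \<and> (i', j) \<in> diagram lam \<longrightarrow> C (T (i, j)) (T (i', j)))}"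

definition tab_sum ::
  "(nat \<Rightarrow> nat \<Rightarrow> bool) \<Rightarrow> (nat \<Rightarrow> nat \<Rightarrow> bool) \<Rightarrow> (nat \<Rightarrow> 'a::comm_semiring_1) \<Rightarrow> nat \<Rightarrow>
     (nat \<Rightarrow> nat) \<Rightarrow> 'a" where
  "tab_sum R C x m lam = (\<Sum>T\<in>tableaux R C m lam. \<Prod>c\<in>diagram lam. x (T c))"

text \<open>The cells of \<open>lam\<close> outside \<open>mu\<close> may all carry the same entry \<open>m\<close>.\<close>

definition strip ::
  "(nat \<Rightarrow> nat \<Rightarrow> bool) \<Rightarrow> (nat \<Rightarrow> nat \<Rightarrow> bool) \<Rightarrow> nat \<Rightarrow> (nat \<Rightarrow> nat) \<Rightarrow> (nat \<Rightarrow> nat) \<Rightarrow> bool" where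
  "strip R C m mu lam \<longleftrightarrow> (\<forall>i. mu i \<le> lam i) \<and>
     (\<forall>i j j'. j < j' \<and> (i, j) \<notin> diagram mu \<and> (i, j') \<in> diagram lam \<longrightarrow> R m m) \<and>
     (\<forall>i i' j. i < i' \<and> (i, j) \<notin> diagram mu \<and> (i', j) \<in> diagram lam \<longrightarrow> C m m)"

lemma mem_diagram [simp]: "(i, j) \<in> diagram lam \<longleftrightarrow> j < lam i"
  by (simp add: diagram_def)

lemma diagram_eq_Sigma:
  assumes "lam \<in> parts n"
  shows "diagram lam = Sigma {..<n} (\<lambda>i. {..<lam i})"
proof -
  have "i < n" if "j < lam i" for i j
    using assms that by (cases "i < n") (auto simp: parts_def)
  then show ?thesis by auto
qed

lemma finite_diagram: "lam \<in> parts n \<Longrightarrow> finite (diagram lam)"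
  by (simp add: diagram_eq_Sigma)

lemma finite_tableaux: "lam \<in> parts n \<Longrightarrow> finite (tableaux R C m lam)"
  unfolding tableaux_def
  by (rule finite_subset[of _ "diagram lam \<rightarrow>\<^sub>E {..<m}"])
    (auto intro: finite_PiE simp: finite_diagram)

lemma finite_parts_below:
  assumes "lam \<in> parts n"
  shows "finite {mu \<in> parts n. \<forall>i. mu i \<le> lam i}"
proof (rule finite_subset)
  show "{mu \<in> parts n. \<forall>i. mu i \<le> lam i} \<subseteq> choices n (\<lambda>i. {..lam i})"
    by (auto simp: choices_def parts_def)
qed (simp add: finite_choices)

lemma prod_skew_diagram:
  fixes c :: "'a::comm_monoid_mult"
  assumes "mu \<in> parts n" "lam \<in> parts n"
  shows "(\<Prod>z\<in>diagram lam - diagram mu. c) = (\<Prod>i<n. c ^ (lam i - mu i))"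
proof -
  have "diagram lam - diagram mu = Sigma {..<n} (\<lambda>i. {mu i..<lam i})"
    unfolding diagram_eq_Sigma[OF assms(1)] diagram_eq_Sigma[OF assms(2)] by auto
  then have "(\<Prod>z\<in>diagram lam - diagram mu. c) = (\<Prod>z\<in>Sigma {..<n} (\<lambda>i. {mu i..<lam i}). c)"
    by simp
  also have "\<dots> = (\<Prod>i<n. \<Prod>j\<in>{mu i..<lam i}. c)"
    by (subst prod.Sigma) auto
  finally show ?thesis by simp
qed

text \<open>A finite down-closed set of naturals is an initial segment. This yields membership rules
  for row lengths and conjugate parts, both of which are defined as cardinalities.\<close>

lemma less_card_down_closed:
  fixes S :: "nat set"
  assumes fin: "finite S" and down: "\<And>i j. j \<in> S \<Longrightarrow> i \<le> j \<Longrightarrow> i \<in> S"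
  shows "i < card S \<longleftrightarrow> i \<in> S"
proof -
  have "\<exists>N. S = {..<N}"
  proof (cases "S = {}")
    case False
    then have "S = {..<Suc (Max S)}"
      unfolding lessThan_Suc_atMost using Max_in[OF fin False] Max_ge[OF fin] down by blast
    then show ?thesis by blast
  next
    case True
    then have "S = {..<0}" by simp
    then show ?thesis by blast
  qed
  then show ?thesis by auto
qed

text \<open>Both relations lie between \<open><\<close> and \<open>\<le>\<close>. Hence entries
  below \<open>m\<close> fill a subdiagram, and a new largest entry \<open>m\<close> may follow any
  smaller one. Strictness matters only for \<open>m\<close> against itself, whence
  \<open>R m m\<close> and \<open>C m m\<close> in \<open>strip\<close>.\<close>

locale tableau_orders =
  fixes R C :: "nat \<Rightarrow> nat \<Rightarrow> bool"
  assumes R_less: "a < b \<Longrightarrow> R a b" and R_le: "R a b \<Longrightarrow> a \<le> b"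
    and C_less: "a < b \<Longrightarrow> C a b" and C_le: "C a b \<Longrightarrow> a \<le> b"
begin

definition shape :: "nat \<Rightarrow> (nat \<Rightarrow> nat) \<Rightarrow> (nat \<times> nat \<Rightarrow> nat) \<Rightarrow> nat \<Rightarrow> nat" where
  "shape m lam T i = card {j. j < lam i \<and> T (i, j) < m}"

lemma less_shape_iff:
  assumes "T \<in> tableaux R C k lam"
  shows "j < shape m lam T i \<longleftrightarrow> j < lam i \<and> T (i, j) < m"
proof -
  let ?S = "{j. j < lam i \<and> T (i, j) < m}"
  have fin: "finite ?S" by simp
  have down: "j \<in> ?S" if "j' \<in> ?S" "j \<le> j'" for j j'
  proof (cases "j = j'")
    case False
    then have "R (T (i, j)) (T (i, j'))"
      using that assms by (auto simp: tableaux_def)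
    then show ?thesis using that R_le[of "T (i, j)" "T (i, j')"] by auto
  qed (use that in simp)
  show ?thesis unfolding shape_def using less_card_down_closed[of ?S j] fin down by auto
qed

text \<open>If row \<open>Suc i\<close> had more entries below \<open>m\<close> than row
  \<open>i\<close>, the cell of row \<open>i\<close> just past its own such entries would lie above
  an entry below \<open>m\<close>, contradicting the column order.\<close>

lemma shape_parts:
  assumes T: "T \<in> tableaux R C k lam" and lam: "lam \<in> parts n"
  shows "shape m lam T \<in> parts n"
proof (rule partsI)
  fix i
  show "shape m lam T (Suc i) \<le> shape m lam T i"
  proof (rule ccontr)
    assume "\<not> ?thesis"
    then have "shape m lam T i < shape m lam T (Suc i)" by simp
    then have *: "shape m lam T i < lam (Suc i)" "T (Suc i, shape m lam T i) < m"
      by (simp_all add: less_shape_iff[OF T])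
    moreover have "lam (Suc i) \<le> lam i" using lam by (simp add: parts_def antimono_Suc)
    moreover have "C (T (i, shape m lam T i)) (T (Suc i, shape m lam T i))"
      using T * by (auto simp: tableaux_def)
    then have "T (i, shape m lam T i) \<le> T (Suc i, shape m lam T i)" by (rule C_le)
    ultimately have "shape m lam T i < shape m lam T i"
      by (subst less_shape_iff[OF T]) auto
    then show False by simp
  qed
next
  show "shape m lam T i = 0" if "i \<ge> n" for i
    using that lam by (simp add: shape_def parts_def)
qed

text \<open>A tableau corresponds to the shape \<open>mu\<close> of its entries below
  \<open>m\<close> together with its restriction to \<open>mu\<close>; the remaining cells all carry
  \<open>m\<close> and contribute the powers of \<open>x m\<close>.\<close>

lemma tab_sum_rec:
  fixes x :: "nat \<Rightarrow> 'a::comm_semiring_1"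
  assumes lam: "lam \<in> parts n"
  shows "tab_sum R C x (Suc m) lam = (\<Sum>mu | mu \<in> parts n \<and> strip R C m mu lam.
    (\<Prod>i<n. x m ^ (lam i - mu i)) * tab_sum R C x m mu)"
proof -
  let ?M = "{mu \<in> parts n. strip R C m mu lam}"
  \<comment> \<open>The inverse map fills the strip with \<open>m\<close>. The value
    \<open>undefined\<close> off \<open>lam\<close> keeps the tableau extensional.\<close>
  define ext where "ext mu T c = (if c \<in> diagram mu then T c else if c \<in> diagram lam then m
    else undefined)" for mu :: "nat \<Rightarrow> nat" and T :: "nat \<times> nat \<Rightarrow> nat" and c
  define w where "w mu T = (\<Prod>i<n. x m ^ (lam i - mu i)) * (\<Prod>c\<in>diagram mu. x (T c))"
    for mu T
  have fin: "finite ?M"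
    by (rule finite_subset[OF _ finite_parts_below[OF lam]]) (auto simp: strip_def)
  have "(\<Sum>mu\<in>?M. (\<Prod>i<n. x m ^ (lam i - mu i)) * tab_sum R C x m mu) =
      (\<Sum>mu\<in>?M. \<Sum>T\<in>tableaux R C m mu. w mu T)"
    by (simp add: tab_sum_def w_def sum_distrib_left)
  also have "\<dots> = (\<Sum>(mu, T)\<in>Sigma ?M (tableaux R C m). w mu T)"
    by (rule sum.Sigma) (use fin finite_tableaux in auto)
  also have "\<dots> = tab_sum R C x (Suc m) lam"
    unfolding tab_sum_def
  proof (rule sum.reindex_bij_witness[of _
      "\<lambda>T. (shape m lam T, restrict T (diagram (shape m lam T)))" "\<lambda>(mu, T). ext mu T"])
    fix p assume "p \<in> Sigma ?M (tableaux R C m)"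
    then obtain mu T where p: "p = (mu, T)" and mu: "mu \<in> parts n" "strip R C m mu lam"
      and T: "T \<in> tableaux R C m mu" by auto
    have le: "mu i \<le> lam i" for i using mu by (simp add: strip_def)
    have sub: "diagram mu \<subseteq> diagram lam"
      by (auto intro: less_le_trans[OF _ le])
    have T_lt: "T (i, j) < m" if "j < mu i" for i j
      using T that by (auto simp: tableaux_def PiE_def Pi_def)
    have T_row: "R (T (i, j)) (T (i, j'))" if "j < j'" "j' < mu i" for i j j'
      using T that by (auto simp: tableaux_def)
    have T_col: "C (T (i, j)) (T (i', j))" if "i < i'" "j < mu i'" for i i' j
      using T that by (auto simp: tableaux_def)
    have mu_anti: "mu i' \<le> mu i" if "i < i'" for i i'
      using mu that parts_antimono[of mu n i i'] by simp
    have lam_anti: "lam i' \<le> lam i" if "i < i'" for i i'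
      using lam that parts_antimono[of lam n i i'] by simp
    have "R (ext mu T (i, j)) (ext mu T (i, j'))" if "j < j'" "j' < lam i" for i j j'
      using that mu T_row[of j j' i] T_lt[of j i] R_less[of "T (i, j)" m]
      by (auto simp: ext_def strip_def)
    moreover have C_strip: "C m m" if "i < i'" "\<not> j < mu i" "j < lam i'" for i i' j
      using mu(2) that unfolding strip_def mem_diagram by blast
    have "C (ext mu T (i, j)) (ext mu T (i', j))" if "i < i'" "j < lam i'" for i i' j
      using that C_strip[of i i' j] T_col[of i i' j] T_lt[of j i] C_less[of "T (i, j)" m] mu_anti[of i i']
        lam_anti[of i i']
      by (auto simp: ext_def)
    moreover have "ext mu T \<in> diagram lam \<rightarrow>\<^sub>E {..<Suc m}"
    proof (rule PiE_I)
      fix c assume "c \<in> diagram lam"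
      then show "ext mu T c \<in> {..<Suc m}"
        using T_lt[of "snd c" "fst c"] by (cases c) (auto simp: ext_def)
    qed (use sub in \<open>auto simp: ext_def\<close>)
    ultimately have ext_tab: "ext mu T \<in> tableaux R C (Suc m) lam"
      by (simp add: tableaux_def)
    then show "(case p of (mu, T) \<Rightarrow> ext mu T) \<in> tableaux R C (Suc m) lam" by (simp add: p)
    have "j < shape m lam (ext mu T) i \<longleftrightarrow> j < mu i" for i j
      unfolding less_shape_iff[OF ext_tab] using le[of i] T_lt[of j i] by (auto simp: ext_def)
    then have shape: "shape m lam (ext mu T) = mu"
      by (intro ext) (metis linorder_neqE_nat less_irrefl)
    have "restrict (ext mu T) (diagram mu) = T"
      using T by (auto simp: restrict_def ext_def tableaux_def fun_eq_iff PiE_def extensional_def)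
    then show "(shape m lam (case p of (mu, T) \<Rightarrow> ext mu T),
        restrict (case p of (mu, T) \<Rightarrow> ext mu T)
          (diagram (shape m lam (case p of (mu, T) \<Rightarrow> ext mu T)))) = p"
      by (simp add: p shape)
    have "(\<Prod>c\<in>diagram lam. x (ext mu T c)) =
        (\<Prod>c\<in>diagram lam - diagram mu. x (ext mu T c)) * (\<Prod>c\<in>diagram mu. x (ext mu T c))"
      by (rule prod.subset_diff[OF sub finite_diagram[OF lam]])
    also have "(\<Prod>c\<in>diagram lam - diagram mu. x (ext mu T c)) = (\<Prod>i<n. x m ^ (lam i - mu i))"
      unfolding prod_skew_diagram[OF mu(1) lam, symmetric]
      by (rule prod.cong) (auto simp: ext_def)
    also have "(\<Prod>c\<in>diagram mu. x (ext mu T c)) = (\<Prod>c\<in>diagram mu. x (T c))"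
      by (rule prod.cong) (auto simp: ext_def)
    finally show "(\<Prod>c\<in>diagram lam. x ((case p of (mu, T) \<Rightarrow> ext mu T) c)) =
        (case p of (mu, T) \<Rightarrow> w mu T)"
      by (simp add: p w_def)
  next
    fix T assume T: "T \<in> tableaux R C (Suc m) lam"
    let ?mu = "shape m lam T"
    have T_le: "T (i, j) \<le> m" if "j < lam i" for i j
      using T that by (auto simp: tableaux_def PiE_def Pi_def less_Suc_eq_le)
    have lam_anti: "lam i' \<le> lam i" if "i < i'" for i i'
      using lam that parts_antimono[of lam n i i'] by simp
    have T_row: "R (T (i, j)) (T (i, j'))" if "j < j'" "j' < lam i" for i j j'
      using T that by (auto simp: tableaux_def)
    have T_col: "C (T (i, j)) (T (i', j))" if "i < i'" "j < lam i'" for i i' j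
      using T that by (auto simp: tableaux_def)
    note iff = less_shape_iff[OF T, of _ m]
    have top: "T (i, j) = m" if "\<not> j < ?mu i" "j < lam i" for i j
      using that T_le[of j i] by (auto simp: iff)
    have R_top: "R m m" if "j < j'" "\<not> j < ?mu i" "j' < lam i" for i j j'
      using T_row[of j j' i] R_le[OF T_row[of j j' i]] T_le[of j' i] top[of j i] that by auto
    have C_top: "C m m" if "i < i'" "\<not> j < ?mu i" "j < lam i'" for i i' j
    proof -
      have "T (i, j) = m" using that lam_anti[of i i'] by (intro top) auto
      moreover have "T (i', j) = m"
        using C_le[OF T_col[of i i' j]] T_le[of j i'] that calculation by auto
      ultimately show ?thesis using T_col[of i i' j] that by simp
    qed
    have mu_le: "?mu i \<le> lam i" for i
      using iff[of "lam i" i] by (metis less_irrefl not_le)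
    have mu: "?mu \<in> ?M"
      using shape_parts[OF T lam, of m] mu_le R_top C_top by (auto simp: strip_def)
    moreover have "restrict T (diagram ?mu) \<in> tableaux R C m ?mu"
    proof -
      have mu_anti: "?mu i' \<le> ?mu i" if "i < i'" for i i'
        using mu that parts_antimono[of ?mu n i i'] by simp
      have "R (restrict T (diagram ?mu) (i, j)) (restrict T (diagram ?mu) (i, j'))"
        if "j < j'" "j' < ?mu i" for i j j'
        using that T_row[of j j' i] mu_le[of i] by (auto simp: restrict_def)
      moreover have "C (restrict T (diagram ?mu) (i, j)) (restrict T (diagram ?mu) (i', j))"
        if "i < i'" "j < ?mu i'" for i i' j
        using that T_col[of i i' j] mu_le[of i'] mu_anti[of i i'] by (auto simp: restrict_def)
      moreover have "T (i, j) < m" if "j < ?mu i" for i j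
        using that by (simp add: iff)
      ultimately show ?thesis by (auto simp: tableaux_def)
    qed
    ultimately show "(?mu, restrict T (diagram ?mu)) \<in> Sigma ?M (tableaux R C m)"
      by simp
    have "ext ?mu (restrict T (diagram ?mu)) (i, j) = T (i, j)" for i j
    proof (cases "j < lam i")
      case True
      then show ?thesis using T_le[of j i] by (auto simp: ext_def restrict_def iff)
    next
      case False
      then show ?thesis using T mu_le[of i]
        by (auto simp: ext_def tableaux_def PiE_def extensional_def)
    qed
    then show "(case (?mu, restrict T (diagram ?mu)) of (mu, T) \<Rightarrow> ext mu T) = T"
      by (auto simp: fun_eq_iff)
  qed
  finally show ?thesis ..
qed

end

section \<open>Tableau sums as Jacobi-Trudi determinants\<close>

lemma tab_sum_0:
  assumes "lam \<in> parts n"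
  shows "tab_sum R C x 0 lam = of_bool (lam = (\<lambda>_. 0))"
proof (cases "lam = (\<lambda>_. 0)")
  case True
  have "diagram lam = {}" unfolding True by auto
  moreover from this have "tableaux R C 0 lam = {\<lambda>_. undefined}"
    unfolding tableaux_def by (simp add: True)
  ultimately show ?thesis by (simp add: tab_sum_def True)
next
  case False
  then obtain i where "0 < lam i" by auto
  then have "(i, 0) \<in> diagram lam" by simp
  then have "diagram lam \<rightarrow>\<^sub>E {..<0::nat} = {}" unfolding PiE_eq_empty_iff by blast
  then have "tableaux R C 0 lam = {}" unfolding tableaux_def by blast
  with False show ?thesis by (simp add: tab_sum_def)
qed

text \<open>Here \<open>C m m\<close> is false, which forbids two strip cells in one column. Column
  \<open>mu i\<close> in rows \<open>i\<close> and \<open>Suc i\<close> gives the interlacing;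
  monotonicity of \<open>lam\<close> reduces lower rows to row \<open>Suc i\<close>.\<close>

lemma strip_le_less_iff: "strip (\<le>) (<) m mu lam \<longleftrightarrow> hstrip mu lam" if "lam \<in> parts n"
proof
  assume s: "strip (\<le>) (<) m mu lam"
  show "hstrip mu lam"
    unfolding hstrip_def
  proof safe
    fix i
    have "\<not> (\<not> mu i < mu i \<and> mu i < lam (Suc i))"
      using s unfolding strip_def mem_diagram by (metis lessI less_irrefl)
    then show "lam (Suc i) \<le> mu i" by simp
    show "mu i \<le> lam i" using s by (simp add: strip_def)
  qed
next
  assume h: "hstrip mu lam"
  have "lam i' \<le> mu i" if "i < i'" for i i'
  proof -
    have "lam i' \<le> lam (Suc i)"
      using \<open>lam \<in> parts n\<close> that parts_antimono[of lam n "Suc i" i'] by simp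
    also have "\<dots> \<le> mu i" using h by (simp add: hstrip_def)
    finally show ?thesis .
  qed
  then show "strip (\<le>) (<) m mu lam"
    using h by (fastforce simp: strip_def hstrip_def)
qed

lemma strip_less_le_iff: "strip (<) (\<le>) m mu lam \<longleftrightarrow> vstrip mu lam"
proof
  assume s: "strip (<) (\<le>) m mu lam"
  show "vstrip mu lam"
    unfolding vstrip_def
  proof safe
    fix i
    \<comment> \<open>Otherwise columns \<open>mu i\<close> and \<open>Suc (mu i)\<close> hold two
      strip cells of row \<open>i\<close>, but \<open>m < m\<close> is false.\<close>
    have "\<not> Suc (mu i) < lam i"
      using s unfolding strip_def mem_diagram by (metis lessI less_irrefl)
    then show "lam i \<le> Suc (mu i)" by simp
    show "mu i \<le> lam i" using s by (simp add: strip_def)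
  qed
next
  assume v: "vstrip mu lam"
  have "lam i \<le> Suc (mu i)" "mu i \<le> lam i" for i using v by (auto simp: vstrip_def)
  then show "strip (<) (\<le>) m mu lam"
    unfolding strip_def mem_diagram by (meson le_trans less_le_trans not_less not_less_eq_eq order_refl)
qed

text \<open>The matrix is the identity for the empty partition; otherwise its first row only has
  positive indices and vanishes.\<close>

lemma jt_zero_vars:
  fixes f :: "int \<Rightarrow> 'a::comm_ring_1"
  assumes f: "\<And>s. f s = of_bool (s = 0)" and lam: "lam \<in> parts n"
  shows "fdet n (\<lambda>i j. f (pos lam i + int j)) = of_bool (lam = (\<lambda>_. 0))"
proof (cases "lam = (\<lambda>_. 0)")
  case True
  then show ?thesis
    by (subst fdet_upper_triangular) (auto simp: f)
next
  case False
  then obtain i where "lam i > 0" by auto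
  moreover have "lam i \<le> lam 0" using lam parts_antimono[of lam n 0 i] by simp
  ultimately have "lam 0 > 0" "0 < n" using lam by (auto simp: parts_def)
  then show ?thesis using False by (auto simp: f intro!: fdet_zero_row[of 0])
qed

text \<open>The Jacobi-Trudi formula: both sides obey the same branching rule in the number of
  variables and agree without variables.\<close>

lemma tab_sum_eq_jt_h:
  fixes x :: "nat \<Rightarrow> 'a::comm_ring_1"
  shows "lam \<in> parts n \<Longrightarrow> tab_sum (\<le>) (<) x m lam = jt_h n x m lam"
proof (induction m arbitrary: lam)
  case 0
  show ?case
    unfolding tab_sum_0[OF 0] jt_h_def by (rule jt_zero_vars[symmetric]) (simp_all add: 0)
next
  case (Suc m)
  interpret tableau_orders "(\<le>)" "(<)" by unfold_locales auto
  show ?case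
    unfolding tab_sum_rec[OF Suc.prems] jt_h_rec[OF Suc.prems] strip_le_less_iff[OF Suc.prems]
    using Suc.IH by (intro sum.cong) auto
qed

text \<open>The dual formula, for tableaux with strict rows and weak columns: the strips removed
  with each variable are now vertical.\<close>

lemma tab_sum_eq_jt_e:
  fixes y :: "nat \<Rightarrow> 'a::comm_ring_1"
  shows "lam \<in> parts n \<Longrightarrow> tab_sum (<) (\<le>) y m lam = jt_e n y m lam"
proof (induction m arbitrary: lam)
  case 0
  show ?case
    unfolding tab_sum_0[OF 0] jt_e_def by (rule jt_zero_vars[symmetric]) (simp_all add: 0)
next
  case (Suc m)
  interpret tableau_orders "(<)" "(\<le>)" by unfold_locales auto
  show ?case
    unfolding tab_sum_rec[OF Suc.prems] jt_e_rec[OF Suc.prems] strip_less_le_iff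
    using Suc.IH by (intro sum.cong) auto
qed

section \<open>Schur polynomials of a partition and of its conjugate\<close>

lemma schur_eq_tab_sum: "schur n lam x = tab_sum (\<le>) (<) x n lam"
  by (simp add: schur_def ssyt_def tab_sum_def tableaux_def)

lemma less_conjugate_iff:
  assumes "lam \<in> parts n"
  shows "j < conjugate lam i \<longleftrightarrow> i < lam j"
proof -
  let ?S = "{j. i < lam j}"
  have "?S \<subseteq> {..<n}" using assms by (auto simp: parts_def intro: ccontr)
  then have fin: "finite ?S" by (rule finite_subset) simp
  have down: "j \<in> ?S" if "j' \<in> ?S" "j \<le> j'" for j j'
    using that parts_antimono[OF assms, of j j'] by auto
  show ?thesis unfolding conjugate_def using less_card_down_closed[of ?S j] fin down by auto
qed

lemma schur_conjugate_eq_tab_sum: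
  assumes lam: "lam \<in> parts n"
  shows "schur k (conjugate lam) y = tab_sum (<) (\<le>) y k lam"
proof -
  note [simp] = less_conjugate_iff[OF lam]
  have dia: "diagram (conjugate lam) = prod.swap ` diagram lam"
  proof -
    have "p \<in> prod.swap ` diagram lam \<longleftrightarrow> prod.swap p \<in> diagram lam" for p
      by (metis image_iff swap_swap)
    then show ?thesis by auto
  qed
  \<comment> \<open>Stated for arbitrary orders and shapes, so that it covers both directions of the
    bijection.\<close>
  have "(\<lambda>c. T (prod.swap c)) \<in> tableaux R C k mu"
    if "T \<in> tableaux C R k nu" "\<And>i j. j < mu i \<longleftrightarrow> i < nu j" for T R C mu nu
    using that by (fastforce simp: tableaux_def PiE_def Pi_def extensional_def)
  note tab = this
  show ?thesis
    unfolding schur_eq_tab_sum tab_sum_def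
  proof (rule sum.reindex_bij_witness[of _ "\<lambda>T c. T (prod.swap c)" "\<lambda>T c. T (prod.swap c)"])
    fix T
    show "(\<Prod>c\<in>diagram lam. y (T (prod.swap c))) = (\<Prod>c\<in>diagram (conjugate lam). y (T c))"
      unfolding dia by (subst prod.reindex) auto
  qed (auto intro!: tab)
qed

section \<open>The dual Cauchy identity\<close>

lemma rect_partitions_eq: "rect_partitions n k = {lam \<in> parts n. \<forall>i. lam i \<le> k}"
proof -
  have "finite {i. lam i \<noteq> 0}" if "\<forall>i\<ge>n. lam i = 0" for lam :: "nat \<Rightarrow> nat"
    by (rule finite_subset[of _ "{..<n}"]) (use that in \<open>auto intro: ccontr\<close>)
  then show ?thesis by (auto simp: rect_partitions_def is_partition_def parts_def)
qed

lemma finite_rect_partitions: "finite (rect_partitions n k)"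
proof (rule finite_subset)
  show "rect_partitions n k \<subseteq> choices n (\<lambda>_. {..k})"
    by (auto simp: rect_partitions_def choices_def)
qed (simp add: finite_choices)

lemma schur_eq_jt_h:
  fixes x :: "nat \<Rightarrow> 'a::comm_ring_1"
  shows "lam \<in> parts n \<Longrightarrow> schur n lam x = jt_h n x n lam"
  by (simp add: schur_eq_tab_sum tab_sum_eq_jt_h)

lemma schur_conjugate_eq_jt_e:
  fixes y :: "nat \<Rightarrow> 'a::comm_ring_1"
  shows "lam \<in> parts n \<Longrightarrow> schur k (conjugate lam) y = jt_e n y k lam"
  by (simp add: schur_conjugate_eq_tab_sum tab_sum_eq_jt_e)

text \<open>Each variable removes at most one cell from row \<open>i\<close>, so \<open>k\<close>
  variables cannot empty a row of more than \<open>k\<close> cells.\<close>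

lemma jt_e_eq_0:
  fixes y :: "nat \<Rightarrow> 'a::comm_ring_1"
  shows "lam \<in> parts n \<Longrightarrow> lam i > k \<Longrightarrow> jt_e n y k lam = 0"
proof (induction k arbitrary: lam)
  case 0
  have "jt_e n y 0 lam = of_bool (lam = (\<lambda>_. 0))"
    unfolding jt_e_def by (rule jt_zero_vars) (use 0 in simp_all)
  then show ?case using 0 by auto
next
  case (Suc k)
  have "jt_e n y k mu = 0" if "mu \<in> parts n" "vstrip mu lam" for mu
  proof (rule Suc.IH[OF that(1)])
    have "lam i \<le> Suc (mu i)" using that(2) by (simp add: vstrip_def)
    then show "k < mu i" using Suc.prems(2) by simp
  qed
  then show ?case
    unfolding jt_e_rec[OF Suc.prems(1)] by (intro sum.neutral) auto
qed

lemma hs_zero [simp]: "hs x m 0 = 1"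
  by (induction m) (simp_all add: hs.simps(2))

text \<open>Branch the second determinant in the last \<open>y\<close>, exchange the sums, and apply
  the Pieri rule to the first determinant.\<close>

lemma dual_Cauchy_jt:
  fixes x y :: "nat \<Rightarrow> 'a::comm_ring_1"
  shows "(\<Sum>lam\<in>rect_partitions n k. jt_h n x n lam * jt_e n y k lam) =
    (\<Prod>i<n. \<Prod>j<k. 1 + x i * y j)"
proof (induction k)
  case 0
  have zero: "(\<lambda>_. 0) \<in> parts n" by (simp add: parts_def)
  then have "rect_partitions n 0 = {\<lambda>_. 0}"
    by (auto simp: rect_partitions_eq)
  moreover have "jt_h n x n (\<lambda>_. 0) = 1"
    unfolding jt_h_def by (subst fdet_upper_triangular) (simp_all add: hs_neg)
  moreover have "jt_e n y 0 (\<lambda>_. 0) = 1"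
    unfolding jt_e_def by (subst jt_zero_vars[OF _ zero]) simp_all
  ultimately show ?case by simp
next
  case (Suc k)
  let ?R = "rect_partitions n (Suc k)"
  define w where "w mu lam = (\<Prod>i<n. y k ^ (lam i - mu i))" for mu lam :: "nat \<Rightarrow> nat"
  have "(\<Sum>lam\<in>?R. jt_h n x n lam * jt_e n y (Suc k) lam) =
      (\<Sum>lam\<in>?R. \<Sum>mu | mu \<in> ?R \<and> vstrip mu lam.
        jt_h n x n lam * (w mu lam * jt_e n y k mu))"
  proof (rule sum.cong[OF refl])
    fix lam assume lam: "lam \<in> ?R"
    then have "{mu \<in> parts n. vstrip mu lam} = {mu \<in> ?R. vstrip mu lam}"
      unfolding rect_partitions_eq vstrip_def by (auto intro: order_trans)
    then show "jt_h n x n lam * jt_e n y (Suc k) lam = (\<Sum>mu | mu \<in> ?R \<and> vstrip mu lam.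
        jt_h n x n lam * (w mu lam * jt_e n y k mu))"
      using lam by (simp add: jt_e_rec rect_partitions_eq sum_distrib_left w_def)
  qed
  also have "\<dots> = (\<Sum>mu\<in>?R. \<Sum>lam | lam \<in> ?R \<and> vstrip mu lam.
      jt_h n x n lam * (w mu lam * jt_e n y k mu))"
    by (rule sum.swap_restrict) (simp_all add: finite_rect_partitions)
  \<comment> \<open>A part of \<open>mu\<close> equal to \<open>Suc k\<close> is too long for the
    \<open>k\<close> remaining variables.\<close>
  also have "\<dots> = (\<Sum>mu\<in>rect_partitions n k. \<Sum>lam | lam \<in> ?R \<and> vstrip mu lam.
      jt_h n x n lam * (w mu lam * jt_e n y k mu))"
  proof (rule sum.mono_neutral_right)
    show "rect_partitions n k \<subseteq> ?R" by (auto simp: rect_partitions_eq le_SucI)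
    show "\<forall>mu\<in>?R - rect_partitions n k. (\<Sum>lam | lam \<in> ?R \<and> vstrip mu lam.
        jt_h n x n lam * (w mu lam * jt_e n y k mu)) = 0"
    proof
      fix mu assume "mu \<in> ?R - rect_partitions n k"
      then obtain i where "mu \<in> parts n" "mu i > k"
        by (auto simp: rect_partitions_eq not_le)
      then have "jt_e n y k mu = 0" by (rule jt_e_eq_0)
      then show "(\<Sum>lam | lam \<in> ?R \<and> vstrip mu lam.
          jt_h n x n lam * (w mu lam * jt_e n y k mu)) = 0" by simp
    qed
  qed (rule finite_rect_partitions)
  also have "\<dots> = (\<Sum>mu\<in>rect_partitions n k.
      (\<Prod>i<n. 1 + x i * y k) * (jt_h n x n mu * jt_e n y k mu))"
  proof (rule sum.cong[OF refl])
    fix mu assume mu: "mu \<in> rect_partitions n k"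
    then have mu': "mu \<in> parts n" by (simp add: rect_partitions_eq)
    \<comment> \<open>Adding a vertical strip to \<open>mu\<close> never leaves the larger
      rectangle, so the inner sum is the full sum of the Pieri rule.\<close>
    have "lam i \<le> Suc k" if "vstrip mu lam" for lam i
      using mu that le_trans[of "lam i" "Suc (mu i)" "Suc k"]
      by (auto simp: rect_partitions_eq vstrip_def)
    then have "{lam \<in> ?R. vstrip mu lam} = {lam \<in> parts n. vstrip mu lam}"
      by (auto simp: rect_partitions_eq)
    then have "(\<Sum>lam | lam \<in> ?R \<and> vstrip mu lam. jt_h n x n lam * (w mu lam * jt_e n y k mu)) =
        (\<Sum>lam | lam \<in> parts n \<and> vstrip mu lam. w mu lam * jt_h n x n lam) * jt_e n y k mu"
      unfolding sum_distrib_right by (simp add: mult_ac)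
    then show "(\<Sum>lam | lam \<in> ?R \<and> vstrip mu lam. jt_h n x n lam * (w mu lam * jt_e n y k mu)) =
        (\<Prod>i<n. 1 + x i * y k) * (jt_h n x n mu * jt_e n y k mu)"
      using Pieri_jt_h[OF mu', of "y k" x] by (simp add: w_def mult.assoc)
  qed
  also have "\<dots> = (\<Prod>i<n. \<Prod>j<Suc k. 1 + x i * y j)"
    unfolding sum_distrib_left[symmetric] Suc.IH by (simp add: prod.distrib mult.commute)
  finally show ?case .
qed

lemma dual_Cauchy_schur:
  fixes x y :: "nat \<Rightarrow> 'a::comm_ring_1"
  shows "(\<Sum>lam\<in>rect_partitions n k. schur n lam x * schur k (conjugate lam) y) =
    (\<Prod>i<n. \<Prod>j<k. 1 + x i * y j)"
  unfolding dual_Cauchy_jt[symmetric]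
  by (rule sum.cong) (auto simp: rect_partitions_eq schur_eq_jt_h schur_conjugate_eq_jt_e)

lemma of_real_schur:
  "complex_of_real (schur n lam x) = schur n lam (\<lambda>i. complex_of_real (x i))"
  by (simp add: schur_def)

lemma schur_nonneg:
  fixes x :: "nat \<Rightarrow> real"
  assumes "\<And>i. i < n \<Longrightarrow> x i \<ge> 0"
  shows "schur n lam x \<ge> 0"
  unfolding schur_def
proof (intro sum_nonneg prod_nonneg)
  fix T c assume "T \<in> ssyt n lam" "c \<in> diagram lam"
  then have "T c \<in> {..<n}" unfolding ssyt_def by (blast dest: PiE_mem)
  then have "T c < n" by simp
  then show "0 \<le> x (T c)" by (rule assms)
qed

section \<open>Contour integrals\<close>

lemma has_contour_integral_powi:
  assumes "valid_path \<gamma>" "pathfinish \<gamma> = pathstart \<gamma>" "0 \<notin> path_image \<gamma>"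
  shows "((\<lambda>z. z powi e) has_contour_integral
    (if e = - 1 then 2 * of_real pi * \<i> * winding_number \<gamma> 0 else 0)) \<gamma>"
proof (cases "e = - 1")
  case True
  then show ?thesis
    using has_contour_integral_winding_number[OF assms(1,3)]
    by (simp add: power_int_minus_left field_simps)
next
  case False
  have "((\<lambda>z. z powi (e + 1) / of_int (e + 1)) has_field_derivative z powi e) (at z within - {0})"
    if "z \<in> - {0}" for z :: complex
  proof -
    have "of_int (e + 1) \<noteq> (0::complex)" using False by (simp only: of_int_eq_0_iff)
    moreover have "((\<lambda>z. z powi (e + 1)) has_field_derivative of_int (e + 1) * z powi e)
        (at z within - {0})"
      using that by (auto intro!: derivative_eq_intros)
    ultimately show ?thesis
      using DERIV_cdivide[of _ "of_int (e + 1) * z powi e" z _ "of_int (e + 1)"] by simp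
  qed
  then have "((\<lambda>z. z powi e) has_contour_integral
      (pathfinish \<gamma> powi (e + 1) / of_int (e + 1) - pathstart \<gamma> powi (e + 1) / of_int (e + 1))) \<gamma>"
    by (rule contour_integral_primitive) (use assms in auto)
  then show ?thesis using False assms by simp
qed

text \<open>For \<open>e \<ge> 0\<close> the integrand is holomorphic in the disc. Negative
  exponents follow downwards from \<open>w^e / (z - w) = (w^e + w^(e+1) / (z - w)) / z\<close>; the
  first summand contributes only for \<open>e = -1\<close>.\<close>

lemma has_contour_integral_powi_over_diff:
  assumes \<gamma>: "valid_path \<gamma>" "pathfinish \<gamma> = pathstart \<gamma>" "0 \<notin> path_image \<gamma>"
    and wind: "winding_number \<gamma> 0 = 1"
    and far: "path_image \<gamma> \<subseteq> ball 0 (norm z)"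
  shows "((\<lambda>w. w powi e / (z - w)) has_contour_integral
    (if e < 0 then 2 * of_real pi * \<i> * z powi e else 0)) \<gamma>"
proof (cases "e < 0")
  case False
  have "(\<lambda>w. w powi e / (z - w)) holomorphic_on ball 0 (norm z)"
    using False by (intro holomorphic_intros) auto
  then show ?thesis
    using Cauchy_theorem_convex_simple[OF _ convex_ball \<gamma>(1) far \<gamma>(2)] False by simp
next
  case True
  have z: "z \<noteq> 0" 
    using far pathstart_in_path_image[of \<gamma>] by (cases "z = 0") auto
  have "((\<lambda>w. w powi (- 1 - int q) / (z - w)) has_contour_integral
      2 * of_real pi * \<i> * z powi (- 1 - int q)) \<gamma>" for q
  proof (induction q)
    case 0
    have "(\<lambda>w. w powi 0 / (z - w)) holomorphic_on ball 0 (norm z)"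
      by (intro holomorphic_intros) auto
    then have "((\<lambda>w. w powi 0 / (z - w)) has_contour_integral 0) \<gamma>"
      by (rule Cauchy_theorem_convex_simple[OF _ convex_ball \<gamma>(1) far \<gamma>(2)])
    from has_contour_integral_add[OF has_contour_integral_powi[OF \<gamma>, of "- 1"] this]
    have "((\<lambda>w. (w powi (- 1) + w powi 0 / (z - w)) / z) has_contour_integral
        (2 * of_real pi * \<i> + 0) / z) \<gamma>"
      by (intro has_contour_integral_div) (simp add: wind)
    then have "((\<lambda>w. w powi (- 1 - int 0) / (z - w)) has_contour_integral
        (2 * of_real pi * \<i> + 0) / z) \<gamma>"
    proof (rule has_contour_integral_eq)
      fix w assume "w \<in> path_image \<gamma>"
      then have "w \<noteq> 0" "z \<noteq> w" using \<gamma> far by auto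
      then show "(w powi (- 1) + w powi 0 / (z - w)) / z = w powi (- 1 - int 0) / (z - w)"
        using z by (simp add: field_simps)
    qed
    then show ?case by (simp add: power_int_minus field_simps)
  next
    case (Suc q)
    from has_contour_integral_add[OF has_contour_integral_powi[OF \<gamma>, of "- 1 - int (Suc q)"] Suc]
    have "((\<lambda>w. (w powi (- 1 - int (Suc q)) + w powi (- 1 - int q) / (z - w)) / z)
        has_contour_integral (2 * of_real pi * \<i> * z powi (- 1 - int q)) / z) \<gamma>"
      by (intro has_contour_integral_div) simp
    then have "((\<lambda>w. w powi (- 1 - int (Suc q)) / (z - w)) has_contour_integral
        (2 * of_real pi * \<i> * z powi (- 1 - int q)) / z) \<gamma>"
    proof (rule has_contour_integral_eq)
      fix w assume "w \<in> path_image \<gamma>"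
      then have w: "w \<noteq> 0" "z \<noteq> w" using \<gamma> far by auto
      have "w powi (- 1 - int q) = w powi (- 1 - int (Suc q)) * w"
        using w power_int_add_1[of w "- 1 - int (Suc q)"] by simp
      then show "(w powi (- 1 - int (Suc q)) + w powi (- 1 - int q) / (z - w)) / z =
          w powi (- 1 - int (Suc q)) / (z - w)"
        using w z by (simp add: field_simps)
    qed
    moreover have "z powi (- 1 - int q) = z powi (- 1 - int (Suc q)) * z"
      using z power_int_add_1[of z "- 1 - int (Suc q)"] by simp
    ultimately show ?case using z by (simp add: mult.assoc)
  qed
  from this[of "nat (- e - 1)"] True show ?thesis by simp
qed

text \<open>All singularities are encircled once, so the contour can be replaced by any large circle
  of radius \<open>R\<close>, on which the integral is \<open>O(1 / R)\<close>.\<close>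

lemma contour_integral_eq_0_of_decay:
  fixes f :: "complex \<Rightarrow> complex"
  assumes fin: "finite A" and holo: "f holomorphic_on - A"
    and \<gamma>: "valid_path \<gamma>" "pathfinish \<gamma> = pathstart \<gamma>" "path_image \<gamma> \<inter> A = {}"
    and wind: "\<And>p. p \<in> A \<Longrightarrow> winding_number \<gamma> p = 1"
    and bound: "\<And>z. norm z \<ge> R0 \<Longrightarrow> norm (f z) \<le> B / norm z ^ 2"
  shows "contour_integral \<gamma> f = 0"
proof -
  obtain R1 where R1: "\<And>p. p \<in> A \<Longrightarrow> norm p < R1"
    using finite_imp_bounded[OF fin] by (auto simp: bounded_pos_less)
  have "norm (contour_integral \<gamma> f) \<le> 2 * pi * B / R" if R: "R > 0" "R \<ge> R0" "R \<ge> R1" for R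
  proof -
    have img: "path_image (circlepath 0 R) \<inter> A = {}"
      using R R1 by fastforce
    \<comment> \<open>Both contours give the same sum of residues, so no residue has to be
      computed.\<close>
    have res: "contour_integral g f = 2 * pi * \<i> * (\<Sum>p\<in>A. residue f p)"
      if "valid_path g" "pathfinish g = pathstart g" "path_image g \<inter> A = {}"
        "\<And>p. p \<in> A \<Longrightarrow> winding_number g p = 1" for g
      using Residue_theorem[of UNIV A f g] that fin holo
      by (simp add: connected_UNIV Compl_eq_Diff_UNIV[symmetric] disjoint_eq_subset_Compl)
    have "winding_number (circlepath 0 R) p = 1" if "p \<in> A" for p
      using R1[OF that] R by (intro winding_number_circlepath) simp
    then have "contour_integral \<gamma> f = contour_integral (circlepath 0 R) f"
      using res[OF \<gamma> wind] res[of "circlepath 0 R"] img by simp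
    moreover have "f contour_integrable_on circlepath 0 R"
      using img fin
      by (intro contour_integrable_holomorphic_simple[OF holo])
        (auto simp: finite_imp_closed open_Compl)
    ultimately have "(f has_contour_integral contour_integral \<gamma> f) (circlepath 0 R)"
      by (simp add: has_contour_integral_integral)
    then have "norm (contour_integral \<gamma> f) \<le> (B / R ^ 2) * (2 * pi * R)"
    proof (rule has_contour_integral_bound_circlepath)
      have "norm (f (of_real R)) \<le> B / R ^ 2"
        using bound[of "of_real R"] R by simp
      then show "0 \<le> B / R ^ 2" by (rule order_trans[OF norm_ge_zero])
    qed (use R bound in auto)
    also have "\<dots> = 2 * pi * B / R" using R by (simp add: power2_eq_square)
    finally show ?thesis .
  qed
  then have "eventually (\<lambda>R. norm (contour_integral \<gamma> f) \<le> 2 * pi * B / R) at_top"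
    by (intro eventually_mono[OF eventually_ge_at_top[of "max 1 (max R0 R1)"]]) auto
  moreover have "((\<lambda>R. 2 * pi * B / R) \<longlongrightarrow> 0) at_top"
    by (rule tendsto_divide_0[OF tendsto_const]) (simp add: filterlim_at_top_imp_at_infinity filterlim_ident)
  ultimately have "norm (contour_integral \<gamma> f) \<le> 0"
    by (intro tendsto_lowerbound[of _ 0 at_top]) auto
  then show ?thesis by simp
qed

lemma one_plus_divide_eq_0_iff:
  fixes z :: "'a::field"
  assumes "z \<noteq> 0"
  shows "1 + c / z = 0 \<longleftrightarrow> z = - c"
proof -
  have "1 + c / z = (z + c) / z" using assms by (simp add: add_divide_distrib)
  then show ?thesis using assms by (simp add: eq_neg_iff_add_eq_0)
qed

section \<open>Substitutes for Laurent coefficients along the z-contour\<close>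

locale kernel_contour =
  fixes X Y :: "nat \<Rightarrow> complex" and n k :: nat and \<gamma> :: "real \<Rightarrow> complex"
  assumes contour: "pos_contour \<gamma>"
    and zero_inside: "0 \<in> inside (path_image \<gamma>)"
    and Y_inside: "j < k \<Longrightarrow> - Y j \<in> inside (path_image \<gamma>)"
    and X_outside: "i < n \<Longrightarrow> X i \<noteq> 0 \<Longrightarrow> inverse (X i) \<in> outside (path_image \<gamma>)"
begin

lemma valid: "valid_path \<gamma>" and closed: "pathfinish \<gamma> = pathstart \<gamma>"
  using contour by (auto simp: pos_contour_def)

lemma winding_inside: "p \<in> inside (path_image \<gamma>) \<Longrightarrow> winding_number \<gamma> p = 1"
  using contour by (auto simp: pos_contour_def)

lemma inside_notin: "p \<in> inside (path_image \<gamma>) \<Longrightarrow> p \<notin> path_image \<gamma>"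
  using inside_no_overlap[of "path_image \<gamma>"] by blast

lemma outside_notin: "p \<in> outside (path_image \<gamma>) \<Longrightarrow> p \<notin> path_image \<gamma>"
  using outside_no_overlap[of "path_image \<gamma>"] by blast

lemma path_nonzero: "z \<in> path_image \<gamma> \<Longrightarrow> z \<noteq> 0"
  using inside_notin[OF zero_inside] by auto

lemma path_X: "z \<in> path_image \<gamma> \<Longrightarrow> i < n \<Longrightarrow> 1 - X i * z \<noteq> 0"
proof
  assume z: "z \<in> path_image \<gamma>" "i < n" and "1 - X i * z = 0"
  then have "X i * z = 1" by simp
  then have "X i \<noteq> 0" "inverse (X i) = z" by (auto intro: inverse_unique)
  then show False using outside_notin[OF X_outside] z by auto
qed

lemma path_Y: "z \<in> path_image \<gamma> \<Longrightarrow> j < k \<Longrightarrow> 1 + Y j / z \<noteq> 0"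
proof
  assume z: "z \<in> path_image \<gamma>" "j < k" and "1 + Y j / z = 0"
  then have "z = - Y j" using path_nonzero[OF z(1)] by (simp add: one_plus_divide_eq_0_iff)
  then show False using inside_notin[OF Y_inside] z by auto
qed

text \<open>The function \<open>K\<close> with only the first \<open>m\<close> and \<open>J\<close>
  factors, so that factors can be removed one at a time.\<close>

definition F :: "nat \<Rightarrow> nat \<Rightarrow> complex \<Rightarrow> complex" where
  "F m J z = (\<Prod>i<m. 1 / (1 - X i * z)) * (\<Prod>j<J. 1 / (1 + Y j / z))"

text \<open>For \<open>m = n\<close> and \<open>J = k\<close> this is the \<open>\<kappa>(s)\<close>
  of the overview.\<close>

definition coef :: "nat \<Rightarrow> nat \<Rightarrow> int \<Rightarrow> complex" where
  "coef m J s = contour_integral \<gamma> (\<lambda>z. F m J z * z powi (- s - 1)) / (2 * of_real pi * \<i>)"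

lemma F_holomorphic:
  assumes "\<And>z i. z \<in> S \<Longrightarrow> i < m \<Longrightarrow> 1 - X i * z \<noteq> 0"
    and "\<And>z j. z \<in> S \<Longrightarrow> j < J \<Longrightarrow> 1 + Y j / z \<noteq> 0"
    and "\<And>z. z \<in> S \<Longrightarrow> 0 < J \<Longrightarrow> z \<noteq> 0"
  shows "F m J holomorphic_on S"
  unfolding F_def[abs_def] using assms by (intro holomorphic_intros) fastforce+

lemma F_integrable:
  assumes "m \<le> n" "J \<le> k"
  shows "(\<lambda>z. F m J z * z powi e) contour_integrable_on \<gamma>"
proof -
  \<comment> \<open>If \<open>X i = 0\<close>, then \<open>inverse (X i) = 0\<close> only repeats a
    point of \<open>A\<close>.\<close>
  define A where "A = insert 0 ((\<lambda>i. inverse (X i)) ` {..<n} \<union> (\<lambda>j. - Y j) ` {..<k})"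
  have "open (- A)" unfolding A_def by (intro open_Compl finite_imp_closed) auto
  moreover have "path_image \<gamma> \<subseteq> - A"
    using path_nonzero outside_notin[OF X_outside] inside_notin[OF Y_inside]
    by (fastforce simp: A_def)
  moreover have "(\<lambda>z. F m J z * z powi e) holomorphic_on - A"
  proof (intro holomorphic_intros F_holomorphic)
    fix z i assume z: "z \<in> - A" "i < m"
    show "1 - X i * z \<noteq> 0"
    proof
      assume "1 - X i * z = 0"
      then have "X i * z = 1" by simp
      then have "inverse (X i) = z" by (rule inverse_unique)
      then show False using z assms by (auto simp: A_def)
    qed
  next
    fix z j assume z: "z \<in> - A" "j < J"
    then have "z \<noteq> - Y j" "z \<noteq> 0" using assms by (auto simp: A_def)
    then show "1 + Y j / z \<noteq> 0" by (simp add: one_plus_divide_eq_0_iff)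
  qed (auto simp: A_def)
  ultimately show ?thesis
    using valid by (intro contour_integrable_holomorphic_simple)
qed

text \<open>Multiply by the missing factor \<open>1 - X m * z\<close>: a further power of
  \<open>z\<close> lowers \<open>s\<close> by one. In \<open>coef_Y\<close> the factor
  \<open>1 + Y J / z\<close> raises it instead.\<close>

lemma coef_X:
  assumes "m < n" "J \<le> k"
  shows "coef m J s = coef (Suc m) J s - X m * coef (Suc m) J (s - 1)"
proof -
  have "contour_integral \<gamma> (\<lambda>z. F m J z * z powi (- s - 1)) =
      contour_integral \<gamma> (\<lambda>z. F (Suc m) J z * z powi (- s - 1) -
        X m * (F (Suc m) J z * z powi (- (s - 1) - 1)))"
  proof (rule contour_integral_eq)
    fix z assume z: "z \<in> path_image \<gamma>"
    have "z powi (- (s - 1) - 1) = z powi (- s - 1) * z"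
      using power_int_add_1[of z "- s - 1"] path_nonzero[OF z] by simp
    moreover have "F m J z = F (Suc m) J z * (1 - X m * z)"
      using path_X[OF z assms(1)] by (simp add: F_def)
    ultimately show "F m J z * z powi (- s - 1) = F (Suc m) J z * z powi (- s - 1) -
        X m * (F (Suc m) J z * z powi (- (s - 1) - 1))"
      by (simp only:) (simp add: algebra_simps)
  qed
  also have "\<dots> = contour_integral \<gamma> (\<lambda>z. F (Suc m) J z * z powi (- s - 1)) -
      X m * contour_integral \<gamma> (\<lambda>z. F (Suc m) J z * z powi (- (s - 1) - 1))"
    using F_integrable[of "Suc m" J] assms
    by (simp add: contour_integral_diff contour_integrable_lmul contour_integral_lmul)
  finally show ?thesis by (simp add: coef_def diff_divide_distrib)
qed

lemma coef_Y:
  assumes "m \<le> n" "J < k"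
  shows "coef m J s = coef m (Suc J) s + Y J * coef m (Suc J) (s + 1)"
proof -
  have "contour_integral \<gamma> (\<lambda>z. F m J z * z powi (- s - 1)) =
      contour_integral \<gamma> (\<lambda>z. F m (Suc J) z * z powi (- s - 1) +
        Y J * (F m (Suc J) z * z powi (- (s + 1) - 1)))"
  proof (rule contour_integral_eq)
    fix z assume z: "z \<in> path_image \<gamma>"
    have "z powi (- s - 1) = z powi (- (s + 1) - 1) * z"
    proof -
      have "- s - 1 = - (s + 1) - 1 + 1" by simp
      then show ?thesis using power_int_add_1[of z "- (s + 1) - 1"] path_nonzero[OF z] by metis
    qed
    then have "z powi (- (s + 1) - 1) = z powi (- s - 1) / z"
      using path_nonzero[OF z] by simp
    moreover have "F m J z = F m (Suc J) z * (1 + Y J / z)"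
      using path_Y[OF z assms(2)] by (simp add: F_def)
    ultimately show "F m J z * z powi (- s - 1) = F m (Suc J) z * z powi (- s - 1) +
        Y J * (F m (Suc J) z * z powi (- (s + 1) - 1))"
      by (simp only:) (simp add: distrib_left distrib_right mult_ac)
  qed
  also have "\<dots> = contour_integral \<gamma> (\<lambda>z. F m (Suc J) z * z powi (- s - 1)) +
      Y J * contour_integral \<gamma> (\<lambda>z. F m (Suc J) z * z powi (- (s + 1) - 1))"
    using F_integrable[of m "Suc J"] assms
    by (simp add: contour_integral_add contour_integrable_lmul contour_integral_lmul)
  finally show ?thesis by (simp add: coef_def add_divide_distrib)
qed

lemma coef_0_0: "coef 0 0 s = of_bool (s = 0)"
  using contour_integral_unique[OF has_contour_integral_powi[OF valid closed, of "- s - 1"]]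
    inside_notin[OF zero_inside] winding_inside[OF zero_inside]
  by (simp add: coef_def F_def)

text \<open>Without \<open>Y\<close> factors and with a nonnegative power of \<open>z\<close>, poles
  can occur only at \<open>inverse (X i)\<close>, outside the contour.\<close>

lemma coef_neg:
  assumes "m \<le> n" "s < 0"
  shows "coef m 0 s = 0"
proof -
  \<comment> \<open>Vanishing \<open>X i\<close> must be left out: \<open>inverse 0 = 0\<close> lies
    inside the contour.\<close>
  define A where "A = (\<lambda>i. inverse (X i)) ` {i. i < n \<and> X i \<noteq> 0}"
  have "((\<lambda>z. F m 0 z * z powi (- s - 1)) has_contour_integral 0) \<gamma>"
  proof (rule Cauchy_theorem_global[of "- A"])
    show "open (- A)" unfolding A_def by (intro open_Compl finite_imp_closed) auto
    show "path_image \<gamma> \<subseteq> - A"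
      using outside_notin[OF X_outside] by (auto simp: A_def)
    show "(\<lambda>z. F m 0 z * z powi (- s - 1)) holomorphic_on - A"
    proof (intro holomorphic_intros F_holomorphic)
      fix z i assume z: "z \<in> - A" "i < m"
      show "1 - X i * z \<noteq> 0"
      proof
        assume "1 - X i * z = 0"
        then have "X i * z = 1" by simp
        then have "X i \<noteq> 0" "z = inverse (X i)" by (auto intro: inverse_unique[symmetric])
        then show False using z assms by (auto simp: A_def)
      qed
    qed (use assms in auto)
    show "winding_number \<gamma> w = 0" if "w \<notin> - A" for w
      using that valid closed X_outside
      by (auto simp: A_def intro!: winding_number_zero_in_outside valid_path_imp_path)
  qed (use valid closed in auto)
  then show ?thesis by (simp add: coef_def contour_integral_unique)
qed

lemma coef_eq_hs: "m \<le> n \<Longrightarrow> coef m 0 s = hs X m s"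
proof (induction m arbitrary: s)
  case 0
  then show ?case by (simp add: coef_0_0)
next
  case (Suc m)
  \<comment> \<open>The induction starts at index \<open>-1\<close>, where both sides
    vanish.\<close>
  have "coef (Suc m) 0 (int t - 1) = hs X (Suc m) (int t - 1)" for t
  proof (induction t)
    case 0
    then show ?case using Suc.prems by (simp add: coef_neg hs_neg)
  next
    case (Suc t)
    then show ?case
      using coef_X[of m 0 "int t"] Suc.IH \<open>Suc m \<le> n\<close> hs_rec[of X m "int t"]
        \<open>\<And>s. m \<le> n \<Longrightarrow> coef m 0 s = hs X m s\<close>[of "int t"]
      by simp
  qed
  from this[of "nat (s + 1)"] show ?case
    using Suc.prems by (cases "s < 0") (auto simp: coef_neg hs_neg)
qed

text \<open>The only possible singularities, 0 and the \<open>- Y j\<close>, lie inside the contour,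
  and for \<open>s \<ge> 1\<close> the integrand decays quadratically. This supplies the vanishing
  hypothesis of \<open>fdet_shift\<close>.\<close>

lemma coef_pos:
  assumes "J \<le> k" "s \<ge> 1"
  shows "coef 0 J s = 0"
proof -
  define A where "A = insert 0 ((\<lambda>j. - Y j) ` {..<J})"
  have A: "p \<in> inside (path_image \<gamma>)" if "p \<in> A" for p
    using that Y_inside zero_inside assms by (auto simp: A_def)
  define M where "M = (\<Sum>j<J. norm (Y j))"
  have "contour_integral \<gamma> (\<lambda>z. F 0 J z * z powi (- s - 1)) = 0"
  \<comment> \<open>Beyond \<open>2 * M + 1\<close> each \<open>Y j / z\<close> has norm at most
    1/2, so each of the \<open>J\<close> factors is at most 2.\<close>
  proof (rule contour_integral_eq_0_of_decay[where A = A and B = "2 ^ J" and ?R0.0 = "2 * M + 1"])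
    show "(\<lambda>z. F 0 J z * z powi (- s - 1)) holomorphic_on - A"
    proof (intro holomorphic_intros F_holomorphic)
      fix z j assume z: "z \<in> - A" "j < J"
      then have "z \<noteq> - Y j" "z \<noteq> 0" by (auto simp: A_def)
      then show "1 + Y j / z \<noteq> 0" by (simp add: one_plus_divide_eq_0_iff)
    qed (auto simp: A_def)
    show "path_image \<gamma> \<inter> A = {}" using A inside_notin by auto
    show "winding_number \<gamma> p = 1" if "p \<in> A" for p
      using A[OF that] by (rule winding_inside)
    fix z :: complex assume z: "norm z \<ge> 2 * M + 1"
    have "M \<ge> 0" by (simp add: M_def sum_nonneg)
    with z have z1: "norm z \<ge> 1" "z \<noteq> 0" by auto
    have "norm (1 / (1 + Y j / z)) \<le> 2" if "j < J" for j
    proof -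
      have "norm (Y j) \<le> M" unfolding M_def using that by (intro member_le_sum) auto
      then have "norm (Y j / z) \<le> 1 / 2" using z z1 by (simp add: norm_divide field_simps)
      then have "norm (1 + Y j / z) \<ge> 1 / 2"
        using norm_triangle_ineq2[of 1 "- (Y j / z)"] by simp
      then show ?thesis
        using le_imp_inverse_le[of "1 / 2" "norm (1 + Y j / z)"]
        by (simp add: norm_divide inverse_eq_divide)
    qed
    then have "(\<Prod>j<J. norm (1 / (1 + Y j / z))) \<le> (\<Prod>j<J. 2)"
      by (intro prod_mono) auto
    then have "norm (F 0 J z) \<le> 2 ^ J" by (simp add: F_def prod_norm[symmetric])
    moreover have "norm (z powi (- s - 1)) \<le> 1 / norm z ^ 2"
    proof -
      have "norm (z powi (- s - 1)) = norm z powi (- s - 1)" by (simp add: norm_power_int)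
      also have "\<dots> \<le> norm z powi (- 2)"
        using z1 assms by (intro power_int_increasing) auto
      finally show ?thesis by (simp add: power_int_minus field_simps)
    qed
    ultimately have "norm (F 0 J z) * norm (z powi (- s - 1)) \<le> 2 ^ J * (1 / norm z ^ 2)"
      by (intro mult_mono) auto
    then show "norm (F 0 J z * z powi (- s - 1)) \<le> 2 ^ J / norm z ^ 2"
      by (simp add: norm_mult)
  qed (use valid closed in \<open>auto simp: A_def\<close>)
  then show ?thesis by (simp add: coef_def)
qed

lemma coef_family:
  assumes "a < n" "J \<le> k"
  shows "coef (n - Suc a) J s = coef (n - a) J s + - X (n - Suc a) * coef (n - a) J (s - 1)"
  using coef_X[of "n - Suc a" J s] assms by (simp add: Suc_diff_Suc)

text \<open>By \<open>coef_Y\<close> the columns for \<open>J\<close> are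
  \<open>1 + Y J * shift\<close> applied to those for \<open>Suc J\<close>, so
  \<open>fdet_shift\<close> extracts one product over \<open>i\<close> for each \<open>Y\<close>
  factor.\<close>

lemma fdet_coef:
  assumes l: "\<And>i. i < n \<Longrightarrow> l i \<ge> 1 - int n"
  shows "J \<le> k \<Longrightarrow> fdet n (\<lambda>i j. hs X n (l i + int j)) =
    (\<Prod>i<n. \<Prod>j<J. 1 + X i * Y j) * fdet n (\<lambda>i j. coef n J (l i + int j))"
proof (induction J)
  case 0
  then show ?case by (simp add: coef_eq_hs)
next
  case (Suc J)
  have "fdet n (\<lambda>i j. coef n J (l i + int j)) =
      fdet n (\<lambda>i j. coef (n - 0) (Suc J) (l i + int j) +
        Y J * coef (n - 0) (Suc J) (l i + int j + 1))"
    by (rule fdet_cong) (use coef_Y Suc.prems in simp)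
  also have "\<dots> = (\<Prod>a<n. 1 - (- X (n - Suc a)) * Y J) *
      fdet n (\<lambda>i j. coef (n - 0) (Suc J) (l i + int j))"
    by (rule fdet_shift[where f = "\<lambda>a. coef (n - a) (Suc J)"])
      (use coef_family coef_pos l Suc.prems in auto)
  also have "(\<Prod>a<n. 1 - (- X (n - Suc a)) * Y J) = (\<Prod>i<n. 1 + X i * Y J)"
    using prod.nat_diff_reindex[of "\<lambda>i. 1 + X i * Y J" n] by simp
  finally show ?case using Suc by (simp add: prod.distrib mult_ac)
qed

end

section \<open>The determinant of the kernel\<close>

lemma prod_eq_sum_es:
  fixes w :: "'a::field"
  assumes "w \<noteq> 0"
  shows "(\<Prod>i<m. 1 + c i * w) = (\<Sum>r\<le>m. es c m (int r) * w powi int r)"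
proof -
  \<comment> \<open>Lowering \<open>s\<close> multiplies by \<open>w\<close>, so the step of
    \<open>es_expand\<close> multiplies by \<open>1 + c a * w\<close>.\<close>
  define f where "f a s = (\<Prod>i<a. 1 + c i * w) * w powi (- s)" for a s
  have "f (Suc a) s = f a s + c a * f a (s - 1)" for a s
  proof -
    have "w powi (- (s - 1)) = w powi (- s) * w"
      using power_int_add_1[of w "- s"] assms by simp
    then show ?thesis by (simp add: f_def algebra_simps)
  qed
  then have "f m 0 = (\<Sum>r\<le>m. es c m (int r) * f 0 (0 - int r))"
    by (intro es_expand[where n = m]) auto
  then show ?thesis by (simp add: f_def)
qed

section \<open>Reduction of the kernel to finite sums\<close>

locale kernel_contours = kernel_contour +
  fixes \<gamma>w :: "real \<Rightarrow> complex"
  assumes w_contour: "pos_contour \<gamma>w"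
    and zero_inside_w: "0 \<in> inside (path_image \<gamma>w)"
    and norm_less: "z \<in> path_image \<gamma> \<Longrightarrow> w \<in> path_image \<gamma>w \<Longrightarrow> norm w < norm z"
begin

text \<open>Reversed, in the order in which \<open>coef_family\<close> removes the
  variables.\<close>

abbreviation c :: "nat \<Rightarrow> complex" where
  "c a \<equiv> - X (n - Suc a)"

text \<open>The part of the kernel belonging to one term of the \<open>Y\<close> product, with
  \<open>b = r - l'\<close>. The condition \<open>q \<le> b\<close> marks the powers of
  \<open>w\<close> that survive integration.\<close>

definition Phi :: "int \<Rightarrow> int \<Rightarrow> complex" where
  "Phi l b = (\<Sum>q\<le>n. es c n (int q) * (if int q \<le> b then coef n k (l + b - int q) else 0))"

text \<open>The reciprocal of \<open>F\<close> is a product of linear factors. Where one of them is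
  zero, \<open>1 / 0 = 0\<close> gives both sides the value 0.\<close>

lemma inverse_F_expand:
  assumes "w \<noteq> 0"
  shows "1 / F n k w =
    (\<Sum>r\<le>k. \<Sum>q\<le>n. es Y k (int r) * es c n (int q) * w powi (int q - int r))"
proof -
  have "1 / F n k w = (\<Prod>j<k. 1 + Y j * (1 / w)) * (\<Prod>i<n. 1 - X i * w)"
    by (simp add: F_def prod_dividef)
  also have "(\<Prod>i<n. 1 - X i * w) = (\<Prod>i<n. 1 + c i * w)"
    using prod.nat_diff_reindex[of "\<lambda>i. 1 - X i * w" n] by simp
  also have "\<dots> = (\<Sum>q\<le>n. es c n (int q) * w powi int q)"
    using assms by (rule prod_eq_sum_es)
  also have "(\<Prod>j<k. 1 + Y j * (1 / w)) = (\<Sum>r\<le>k. es Y k (int r) * (1 / w) powi int r)"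
    using assms by (intro prod_eq_sum_es) simp
  also have "\<dots> * (\<Sum>q\<le>n. es c n (int q) * w powi int q) =
      (\<Sum>r\<le>k. \<Sum>q\<le>n. es Y k (int r) * es c n (int q) * w powi (int q - int r))"
    unfolding sum_product using assms
    by (intro sum.cong refl) (simp add: power_int_diff power_one_over field_simps)
  finally show ?thesis .
qed

text \<open>Expanding \<open>1 / F n k w\<close> leaves integrals of \<open>w^e / (z - w)\<close>
  with \<open>e = l' - 1 + q - r\<close>, and these vanish unless \<open>e < 0\<close>.\<close>

lemma inner_integral:
  assumes z: "z \<in> path_image \<gamma>"
  shows "contour_integral \<gamma>w (\<lambda>w. 1 / (2 * of_real pi * \<i> * z) * (1 / (2 * of_real pi * \<i> * w)) *
      (F n k z / F n k w) * (z powi (1 - l) * w powi l') / (z - w)) =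
    (\<Sum>r\<le>k. \<Sum>q\<le>n. es Y k (int r) * es c n (int q) *
      (if int q \<le> int r - l'
       then F n k z * z powi (- (l - l' + int r - int q) - 1) / (2 * of_real pi * \<i>) else 0))"
proof -
  define t where "t r q = es Y k (int r) * es c n (int q)" for r q :: nat
  \<comment> \<open>All factors of the integrand that do not depend on \<open>w\<close>.\<close>
  define A where "A = F n k z * z powi (- l) / (2 * of_real pi * \<i>) ^ 2"
  have w0: "0 \<notin> path_image \<gamma>w"
    using inside_no_overlap[of "path_image \<gamma>w"] zero_inside_w by blast
  have z0: "z \<noteq> 0" using z by (rule path_nonzero)
  have hci: "((\<lambda>w. w powi e / (z - w)) has_contour_integral
      (if e < 0 then 2 * of_real pi * \<i> * z powi e else 0)) \<gamma>w" for e
    using w_contour zero_inside_w norm_less[OF z] w0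
    by (intro has_contour_integral_powi_over_diff) (auto simp: pos_contour_def)
  have "((\<lambda>w. A * (\<Sum>r\<le>k. \<Sum>q\<le>n. t r q * (w powi (l' - 1 + int q - int r) / (z - w))))
      has_contour_integral A * (\<Sum>r\<le>k. \<Sum>q\<le>n. t r q *
        (if l' - 1 + int q - int r < 0
         then 2 * of_real pi * \<i> * z powi (l' - 1 + int q - int r) else 0))) \<gamma>w"
    by (intro has_contour_integral_lmul has_contour_integral_sum hci) auto
  then have "((\<lambda>w. 1 / (2 * of_real pi * \<i> * z) * (1 / (2 * of_real pi * \<i> * w)) *
      (F n k z / F n k w) * (z powi (1 - l) * w powi l') / (z - w))
      has_contour_integral A * (\<Sum>r\<le>k. \<Sum>q\<le>n. t r q *
        (if l' - 1 + int q - int r < 0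
         then 2 * of_real pi * \<i> * z powi (l' - 1 + int q - int r) else 0))) \<gamma>w"
  proof (rule has_contour_integral_eq)
    fix w assume w: "w \<in> path_image \<gamma>w"
    have w_nz: "w \<noteq> 0" using w w0 by auto
    have "z \<noteq> w" using norm_less[OF z w] by auto
    have pz: "z powi (1 - l) = z * z powi (- l)"
      using power_int_add[of z 1 "- l"] z0 by simp
    have pw: "w powi l' = w * w powi (l' - 1)"
      using power_int_add[of w 1 "l' - 1"] w_nz by simp
    have "(\<Sum>r\<le>k. \<Sum>q\<le>n. t r q * (w powi (l' - 1 + int q - int r) / (z - w))) =
        (\<Sum>r\<le>k. \<Sum>q\<le>n. t r q * w powi (int q - int r)) * (w powi (l' - 1) / (z - w))"
      unfolding sum_distrib_right
    proof (intro sum.cong refl)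
      fix r q
      have "l' - 1 + int q - int r = (int q - int r) + (l' - 1)" by simp
      then have "w powi (l' - 1 + int q - int r) = w powi (int q - int r) * w powi (l' - 1)"
        using power_int_add[of w "int q - int r" "l' - 1"] w_nz by metis
      then show "t r q * (w powi (l' - 1 + int q - int r) / (z - w)) =
          t r q * w powi (int q - int r) * (w powi (l' - 1) / (z - w))" by simp
    qed
    also have "\<dots> = 1 / F n k w * (w powi (l' - 1) / (z - w))"
      using w_nz by (simp add: inverse_F_expand t_def)
    finally have sum_eq: "(\<Sum>r\<le>k. \<Sum>q\<le>n. t r q * (w powi (l' - 1 + int q - int r) / (z - w))) =
        1 / F n k w * (w powi (l' - 1) / (z - w))" .
    show "A * (\<Sum>r\<le>k. \<Sum>q\<le>n. t r q * (w powi (l' - 1 + int q - int r) / (z - w))) =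
        1 / (2 * of_real pi * \<i> * z) * (1 / (2 * of_real pi * \<i> * w)) *
        (F n k z / F n k w) * (z powi (1 - l) * w powi l') / (z - w)"
      unfolding sum_eq pz pw A_def using z0 w_nz by (simp add: power2_eq_square mult_ac)
  qed
  then have "contour_integral \<gamma>w (\<lambda>w. 1 / (2 * of_real pi * \<i> * z) *
      (1 / (2 * of_real pi * \<i> * w)) *
      (F n k z / F n k w) * (z powi (1 - l) * w powi l') / (z - w)) =
      A * (\<Sum>r\<le>k. \<Sum>q\<le>n. t r q * (if l' - 1 + int q - int r < 0
         then 2 * of_real pi * \<i> * z powi (l' - 1 + int q - int r) else 0))"
    by (rule contour_integral_unique)
  also have "\<dots> = (\<Sum>r\<le>k. \<Sum>q\<le>n. t r q * (if int q \<le> int r - l'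
       then F n k z * z powi (- (l - l' + int r - int q) - 1) / (2 * of_real pi * \<i>) else 0))"
    unfolding sum_distrib_left
  proof (intro sum.cong refl)
    fix r q
    have less_iff: "l' - 1 + int q - int r < 0 \<longleftrightarrow> int q \<le> int r - l'" by auto
    have e: "- (l - l' + int r - int q) - 1 = - l + (l' - 1 + int q - int r)" by simp
    have "z powi (- (l - l' + int r - int q) - 1) = z powi (- l) * z powi (l' - 1 + int q - int r)"
      unfolding e using z0 by (intro power_int_add) simp
    moreover have cancel: "G * q / C ^ 2 * (C * p) = G * (q * p) / C" if "C \<noteq> 0"
      for C G p q :: complex
      using that by (simp add: power2_eq_square)
    have "A * (2 * of_real pi * \<i> * p) = F n k z * (z powi (- l) * p) / (2 * of_real pi * \<i>)"
      for p
      unfolding A_def by (rule cancel) simp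
    ultimately have key: "A * (2 * of_real pi * \<i> * z powi (l' - 1 + int q - int r)) =
        F n k z * z powi (- (l - l' + int r - int q) - 1) / (2 * of_real pi * \<i>)"
      by (simp only:)
    show "A * (t r q * (if l' - 1 + int q - int r < 0
         then 2 * of_real pi * \<i> * z powi (l' - 1 + int q - int r) else 0)) =
      t r q * (if int q \<le> int r - l'
       then F n k z * z powi (- (l - l' + int r - int q) - 1) / (2 * of_real pi * \<i>) else 0)"
    proof (cases "int q \<le> int r - l'")
      case True
      with key show ?thesis
        by (simp only: less_iff if_True mult.left_commute[of A "t r q"])
    qed (simp add: less_iff)
  qed
  finally show ?thesis by (simp add: t_def)
qed

lemma double_integral:
  "contour_integral \<gamma> (\<lambda>z. contour_integral \<gamma>w (\<lambda>w.
      1 / (2 * of_real pi * \<i> * z) * (1 / (2 * of_real pi * \<i> * w)) *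
      (F n k z / F n k w) * (z powi (1 - l) * w powi l') / (z - w))) =
    (\<Sum>r\<le>k. es Y k (int r) * Phi l (int r - l'))"
proof -
  have "((\<lambda>z. F n k z * z powi (- s - 1) / (2 * of_real pi * \<i>)) has_contour_integral
      coef n k s) \<gamma>" for s
    unfolding coef_def
    by (intro has_contour_integral_div has_contour_integral_integral F_integrable) auto
  then have "((\<lambda>z. if P then F n k z * z powi (- s - 1) / (2 * of_real pi * \<i>) else 0)
      has_contour_integral (if P then coef n k s else 0)) \<gamma>" for s P
    by (cases P) (simp_all add: has_contour_integral_0)
  then have "((\<lambda>z. \<Sum>r\<le>k. \<Sum>q\<le>n. es Y k (int r) * es c n (int q) *
      (if int q \<le> int r - l'
       then F n k z * z powi (- (l - l' + int r - int q) - 1) / (2 * of_real pi * \<i>) else 0))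
      has_contour_integral (\<Sum>r\<le>k. \<Sum>q\<le>n. es Y k (int r) * es c n (int q) *
        (if int q \<le> int r - l' then coef n k (l - l' + int r - int q) else 0))) \<gamma>"
    by (intro has_contour_integral_sum has_contour_integral_lmul) auto
  then have "((\<lambda>z. contour_integral \<gamma>w (\<lambda>w.
      1 / (2 * of_real pi * \<i> * z) * (1 / (2 * of_real pi * \<i> * w)) *
      (F n k z / F n k w) * (z powi (1 - l) * w powi l') / (z - w)))
      has_contour_integral (\<Sum>r\<le>k. \<Sum>q\<le>n. es Y k (int r) * es c n (int q) *
        (if int q \<le> int r - l' then coef n k (l - l' + int r - int q) else 0))) \<gamma>"
    by (rule has_contour_integral_eq) (simp only: inner_integral)
  then have "contour_integral \<gamma> (\<lambda>z. contour_integral \<gamma>w (\<lambda>w.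
      1 / (2 * of_real pi * \<i> * z) * (1 / (2 * of_real pi * \<i> * w)) *
      (F n k z / F n k w) * (z powi (1 - l) * w powi l') / (z - w))) =
      (\<Sum>r\<le>k. \<Sum>q\<le>n. es Y k (int r) * es c n (int q) *
        (if int q \<le> int r - l' then coef n k (l - l' + int r - int q) else 0))"
    by (rule contour_integral_unique)
  also have "\<dots> = (\<Sum>r\<le>k. es Y k (int r) * Phi l (int r - l'))"
    unfolding Phi_def sum_distrib_left
    by (intro sum.cong refl) (simp add: algebra_simps)
  finally show ?thesis .
qed

lemma Phi_neg: "b < 0 \<Longrightarrow> Phi l b = 0"
  by (simp add: Phi_def)

text \<open>For \<open>b \<ge> n\<close> nothing is truncated, and the sum removes every
  \<open>X\<close> factor by \<open>es_expand\<close>; \<open>coef_pos\<close> applies to what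
  remains.\<close>

lemma Phi_large:
  assumes "b \<ge> int n" "l + b \<ge> 1"
  shows "Phi l b = 0"
proof -
  have "Phi l b = (\<Sum>q\<le>n. es c n (int q) * coef (n - 0) k (l + b - int q))"
    unfolding Phi_def using assms by (intro sum.cong) auto
  also have "\<dots> = coef (n - n) k (l + b)"
    by (rule es_expand[where f = "\<lambda>a. coef (n - a) k" and n = n, symmetric])
      (use coef_family in auto)
  also have "\<dots> = 0" using coef_pos[of k "l + b"] assms by simp
  finally show ?thesis .
qed

text \<open>With \<open>b = r - l'\<close>, \<open>Phi\<close> restricts the sum to
  \<open>0 \<le> b < n\<close> and \<open>es\<close> restricts \<open>l' + b\<close> to the range
  from 0 to \<open>k\<close>. The kernel matrix thus factors through size \<open>n\<close>.\<close>

lemma kernel_eq_sum: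
  assumes "l \<ge> 1 - int n"
  shows "(\<Sum>r\<le>k. es Y k (int r) * Phi l (int r - l')) =
    (\<Sum>b<n. Phi l (int b) * es Y k (l' + int b))"
proof -
  let ?A = "{r. r \<le> k \<and> 0 \<le> int r - l' \<and> int r - l' < int n}"
  let ?B = "{b. b < n \<and> 0 \<le> l' + int b \<and> l' + int b \<le> int k}"
  have "Phi l (int r - l') = 0" if "r \<in> {..k} - ?A" for r
    using that assms Phi_neg[of "int r - l'" l] Phi_large[of "int r - l'" l] by force
  then have "(\<Sum>r\<le>k. es Y k (int r) * Phi l (int r - l')) =
      (\<Sum>r\<in>?A. es Y k (int r) * Phi l (int r - l'))"
    by (intro sum.mono_neutral_right) auto
  also have "\<dots> = (\<Sum>b\<in>?B. Phi l (int b) * es Y k (l' + int b))"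
    by (rule sum.reindex_bij_witness[of _ "\<lambda>b. nat (l' + int b)" "\<lambda>r. nat (int r - l')"]) auto
  also have "\<dots> = (\<Sum>b<n. Phi l (int b) * es Y k (l' + int b))"
  proof (rule sum.mono_neutral_left)
    have "es Y k (l' + int b) = 0" if "b \<in> {..<n} - ?B" for b
      using that es_neg[of "l' + int b" Y k] es_gt[of k "l' + int b" Y] by force
    then show "\<forall>b\<in>{..<n} - ?B. Phi l (int b) * es Y k (l' + int b) = 0" by auto
  qed auto
  finally show ?thesis .
qed

text \<open>For \<open>b < n\<close> the truncation keeps exactly the columns
  \<open>t = b - q\<close> with \<open>0 \<le> t \<le> b\<close>, so \<open>Phi\<close> is the
  \<open>coef\<close> matrix times a unitriangular one.\<close>

lemma fdet_Phi: "fdet n (\<lambda>i b. Phi (l i) (int b)) = fdet n (\<lambda>i j. coef n k (l i + int j))"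
proof -
  have "fdet n (\<lambda>i b. Phi (l i) (int b)) =
      fdet n (\<lambda>i b. \<Sum>t<n. coef n k (l i + int t) * es c n (int b - int t))"
  proof (rule fdet_cong)
    fix i b assume "b < n"
    have "Phi (l i) (int b) = (\<Sum>q\<le>b. es c n (int q) * coef n k (l i + int b - int q))"
      unfolding Phi_def using \<open>b < n\<close> by (intro sum.mono_neutral_cong_right) auto
    also have "\<dots> = (\<Sum>t\<le>b. coef n k (l i + int t) * es c n (int b - int t))"
      by (rule sum.reindex_bij_witness[of _ "\<lambda>t. b - t" "\<lambda>q. b - q"])
        (auto simp: of_nat_diff mult.commute algebra_simps)
    also have "\<dots> = (\<Sum>t<n. coef n k (l i + int t) * es c n (int b - int t))"
      using \<open>b < n\<close> by (intro sum.mono_neutral_left) (auto simp: es_neg)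
    finally show "Phi (l i) (int b) =
      (\<Sum>t<n. coef n k (l i + int t) * es c n (int b - int t))" .
  qed
  also have "\<dots> = fdet n (\<lambda>i j. coef n k (l i + int j))"
    by (simp add: fdet_mult fdet_upper_triangular[of n "\<lambda>t b. es c n (int b - int t)"] es_neg)
  finally show ?thesis .
qed

lemma fdet_double_integral:
  assumes lam: "lam \<in> parts n"
  shows "(\<Prod>i<n. \<Prod>j<k. 1 + X i * Y j) *
    fdet n (\<lambda>i j. contour_integral \<gamma> (\<lambda>z. contour_integral \<gamma>w (\<lambda>w.
      1 / (2 * of_real pi * \<i> * z) * (1 / (2 * of_real pi * \<i> * w)) *
      (F n k z / F n k w) * (z powi (1 - pos lam i) * w powi (pos lam j)) / (z - w)))) =
    schur n lam X * schur k (conjugate lam) Y"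
proof -
  have l: "pos lam i \<ge> 1 - int n" if "i < n" for i using that by simp
  have "fdet n (\<lambda>i j. \<Sum>r\<le>k. es Y k (int r) * Phi (pos lam i) (int r - pos lam j)) =
      fdet n (\<lambda>i j. \<Sum>b<n. Phi (pos lam i) (int b) * es Y k (pos lam j + int b))"
    by (rule fdet_cong) (use kernel_eq_sum l in simp)
  \<comment> \<open>The second factor is the transpose of the matrix in \<open>jt_e\<close>.\<close>
  also have "\<dots> = fdet n (\<lambda>i j. coef n k (pos lam i + int j)) * jt_e n Y k lam"
    using fdet_transpose[of n "\<lambda>i j. es Y k (pos lam i + int j)"]
    by (simp add: fdet_mult fdet_Phi jt_e_def)
  finally have det: "fdet n (\<lambda>i j. \<Sum>r\<le>k. es Y k (int r) * Phi (pos lam i) (int r - pos lam j)) =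
    fdet n (\<lambda>i j. coef n k (pos lam i + int j)) * jt_e n Y k lam" .
  show ?thesis
    unfolding double_integral det
    using fdet_coef[of "pos lam" k, OF l]
    by (simp add: schur_eq_jt_h[OF lam] schur_conjugate_eq_jt_e[OF lam] jt_h_def
        mult.assoc)
qed

end

lemma floor_half_pos:
  "\<lfloor>- half_pos lam i + 1 / 2\<rfloor> = 1 - pos lam i" "\<lfloor>half_pos lam i + 1 / 2\<rfloor> = pos lam i"
proof -
  have "- half_pos lam i + 1 / 2 = of_int (1 - pos lam i)" by (simp add: half_pos_def)
  then show "\<lfloor>- half_pos lam i + 1 / 2\<rfloor> = 1 - pos lam i" by (simp only: floor_of_int)
  have "half_pos lam i + 1 / 2 = of_int (pos lam i)" by (simp add: half_pos_def)
  then show "\<lfloor>half_pos lam i + 1 / 2\<rfloor> = pos lam i" by (simp only: floor_of_int)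
qed

text \<open>The origin is inside the w-contour, which lies inside the z-contour, and is not on the
  latter because there \<open>norm z > norm w \<ge> 0\<close>.\<close>

lemma kernel_contours_of_admissible:
  assumes "admissible_contours n k x y \<gamma>z \<gamma>w"
  shows "kernel_contours (\<lambda>i. of_real (x i)) (\<lambda>j. of_real (y j)) n k \<gamma>z \<gamma>w"
proof
  note adm = assms[unfolded admissible_contours_def]
  show "0 \<in> inside (path_image \<gamma>z)"
  proof -
    have "0 \<notin> path_image \<gamma>z"
      using adm pathstart_in_path_image[of \<gamma>w] norm_ge_zero by (metis norm_zero not_less)
    then show ?thesis
      using adm inside_inside[of "path_image \<gamma>w" "path_image \<gamma>z"] by blast
  qed
qed (use assms in \<open>auto simp: admissible_contours_def\<close>)

theorem theorem1p1:
  fixes n k :: nat and x y :: "nat \<Rightarrow> real"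
  assumes "n \<ge> 1" and "k \<ge> 1"
    and "\<And>i. i < n \<Longrightarrow> x i \<ge> 0" and "\<And>j. j < k \<Longrightarrow> y j \<ge> 0"
  shows "prob_space (schur_measure n k x y) \<and>
    (\<forall>\<gamma>z \<gamma>w. admissible_contours n k x y \<gamma>z \<gamma>w \<longrightarrow>
      (\<forall>lam\<in>rect_partitions n k.
        complex_of_real (measure (schur_measure n k x y) {lam}) =
        Determinant.det (Matrix.mat n n
          (\<lambda>(i, j). corr_kernel n k x y \<gamma>z \<gamma>w (half_pos lam i) (half_pos lam j)))))"
proof (intro conjI allI impI ballI)
  define Z where "Z = (\<Prod>i<n. \<Prod>j<k. 1 + x i * y j)"
  define p where "p lam = schur n lam x * schur k (conjugate lam) y / Z" for lam
  have "Z > 0"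
    unfolding Z_def using assms by (intro prod_pos) (auto intro: add_pos_nonneg)
  have p_nonneg: "p lam \<ge> 0" for lam
    using \<open>Z > 0\<close> schur_nonneg[of n x lam] schur_nonneg[of k y "conjugate lam"] assms
    by (simp add: p_def)
  have measure_def: "schur_measure n k x y = point_measure (rect_partitions n k) (\<lambda>lam. ennreal (p lam))"
    by (simp add: schur_measure_def p_def Z_def)
  \<comment> \<open>The dual Cauchy identity says that the weights before normalization sum to
    \<open>Z\<close>.\<close>
  have "(\<Sum>lam\<in>rect_partitions n k. p lam) = Z / Z"
    unfolding p_def sum_divide_distrib[symmetric] dual_Cauchy_schur by (simp only: Z_def)
  with \<open>Z > 0\<close> have "(\<Sum>lam\<in>rect_partitions n k. p lam) = 1" by simp
  then have "(\<Sum>lam\<in>rect_partitions n k. ennreal (p lam)) = 1"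
    using p_nonneg by (simp add: sum_ennreal)
  then show "prob_space (schur_measure n k x y)"
    unfolding measure_def by (intro prob_space_point_measure) (auto simp: finite_rect_partitions)
  fix \<gamma>z \<gamma>w lam
  assume adm: "admissible_contours n k x y \<gamma>z \<gamma>w" and lam: "lam \<in> rect_partitions n k"
  interpret kernel_contours "\<lambda>i. of_real (x i)" "\<lambda>j. of_real (y j)" n k \<gamma>z \<gamma>w
    using adm by (rule kernel_contours_of_admissible)
  have K: "K_fun n k x y = F n k"
    by (simp add: K_fun_def F_def fun_eq_iff)
  have "measure (schur_measure n k x y) {lam} = p lam"
    using lam p_nonneg
    by (simp add: measure_def Sigma_Algebra.measure_def emeasure_point_measure_finite
        finite_rect_partitions)
  moreover have D: "Determinant.det (Matrix.mat n n
      (\<lambda>(i, j). corr_kernel n k x y \<gamma>z \<gamma>w (half_pos lam i) (half_pos lam j))) =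
    fdet n (\<lambda>i j. contour_integral \<gamma>z (\<lambda>z. contour_integral \<gamma>w (\<lambda>w.
      1 / (2 * of_real pi * \<i> * z) * (1 / (2 * of_real pi * \<i> * w)) *
      (F n k z / F n k w) * (z powi (1 - pos lam i) * w powi (pos lam j)) / (z - w))))"
    unfolding corr_kernel_def floor_half_pos K fdet_def ..
  have "lam \<in> parts n" using lam by (simp add: rect_partitions_eq)
  from fdet_double_integral[OF this]
  have "complex_of_real Z * Determinant.det (Matrix.mat n n
      (\<lambda>(i, j). corr_kernel n k x y \<gamma>z \<gamma>w (half_pos lam i) (half_pos lam j))) =
      of_real (schur n lam x * schur k (conjugate lam) y)"
    unfolding D by (simp add: Z_def of_real_schur)
  then have "Determinant.det (Matrix.mat n n
      (\<lambda>(i, j). corr_kernel n k x y \<gamma>z \<gamma>w (half_pos lam i) (half_pos lam j))) = of_real (p lam)"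
    using \<open>Z > 0\<close> by (simp add: p_def eq_divide_eq mult.commute)
  ultimately show "complex_of_real (measure (schur_measure n k x y) {lam}) =
      Determinant.det (Matrix.mat n n
        (\<lambda>(i, j). corr_kernel n k x y \<gamma>z \<gamma>w (half_pos lam i) (half_pos lam j)))"
    by simp
qed

end
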